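(* (a) Let $G$ be a $CD1$-group. Then $\{1\}\cup b^G\subseteq G'$, so $|G'|\ge 1+|b^G|$. Moreover, the row of $\chi_k$ in the character table of $G$ is $(a_k,b_k,0,0,\dots,0)$, where the first column corresponds to the class $\{1\}$ and the second to the class $b^G$; that is, $\chi_k(1)=a_k$, $\chi_k(b)=b_k$ and $\chi_k(x)=0$ for all $x\in G\setminus(\{1\}\cup b^G)$. Hence the non-unit special class $b^G$ is unique. (b) A finite group $G$ with $|G|>2$ is a $CD1$-group if and only if $G$ has an irreducible complex character which vanishes on all but two conjugacy classes of $G$.
   Context: All groups are finite. Let $\mathrm{Irr}(G)=\{\chi_1,\dots,\chi_k\}$ be the set of complex irreducible characters of $G$, with $\chi_1=1_G$ and $\chi_1(1)=1\le\chi_2(1)\le\dots\le\chi_k(1)$. A group $G$ is a $CD1$-group if $|G|>2$ and two columns of its character table differ by exactly one entry, i.e. there are $a,b\in G$ and an index $j$ with $\chi_j(a)\ne\chi_j(b)$ and $\chi_i(a)=\chi_i(b)$ for all $i\ne j$; two such conjugacy classes $a^G,b^G$ are called special classes. It is known that one of the two special classes is $\{1\}$ and that $j=k$; let $b^G$ be the other one. Put $a_i=\chi_i(1)$ and $b_i=\chi_i(b)$. $G'$ is the commutator subgroup of $G$. *)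

theory Defs
  imports
    "HOL-Algebra.Algebra"
    "Jordan_Normal_Form.VS_Connect"
begin

definition mat_trace :: "complex mat \<Rightarrow> complex" where
  "mat_trace A = (\<Sum>i<dim_row A. A $$ (i, i))"

definition group_representation ::
  "('a, 'b) monoid_scheme \<Rightarrow> nat \<Rightarrow> ('a \<Rightarrow> complex mat) \<Rightarrow> bool" where
  "group_representation G n \<rho> \<longleftrightarrow> \<rho> \<in> hom G (units_of (ring_mat TYPE(complex) n ()))"

definition irreducible_representation ::
  "('a, 'b) monoid_scheme \<Rightarrow> nat \<Rightarrow> ('a \<Rightarrow> complex mat) \<Rightarrow> bool" where
  "irreducible_representation G n \<rho> \<longleftrightarrow>
     group_representation G n \<rho> \<and> n > 0 \<and>
     (\<forall>W. VectorSpace.subspace class_ring W (module_vec TYPE(complex) n) \<and>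
          (\<forall>g\<in>carrier G. \<forall>w\<in>W. \<rho> g *\<^sub>v w \<in> W) \<longrightarrow>
          W = {0\<^sub>v n} \<or> W = carrier_vec n)"

text \<open>Characters are restricted to the carrier (with value \<^term>\<open>undefined\<close> outside),
  so that equality of characters is equality on the group.\<close>

definition Irr :: "('a, 'b) monoid_scheme \<Rightarrow> ('a \<Rightarrow> complex) set" where
  "Irr G = {\<lambda>g\<in>carrier G. mat_trace (\<rho> g) | n \<rho>. irreducible_representation G n \<rho>}"

text \<open>The degrees \<open>\<chi> i \<one>\<close> are positive integers, viewed as complex numbers; the real part
  only serves to compare them.\<close>

definition irr_enumeration ::
  "('a, 'b) monoid_scheme \<Rightarrow> nat \<Rightarrow> (nat \<Rightarrow> 'a \<Rightarrow> complex) \<Rightarrow> bool" where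
  "irr_enumeration G k \<chi> \<longleftrightarrow>
     bij_betw \<chi> {1..k} (Irr G) \<and>
     \<chi> 1 = (\<lambda>g\<in>carrier G. 1) \<and>
     (\<forall>i\<in>{1..k}. \<forall>j\<in>{1..k}. i \<le> j \<longrightarrow> Re (\<chi> i \<one>\<^bsub>G\<^esub>) \<le> Re (\<chi> j \<one>\<^bsub>G\<^esub>))"

definition conj_action :: "('a, 'b) monoid_scheme \<Rightarrow> 'a \<Rightarrow> 'a \<Rightarrow> 'a" where
  "conj_action G = (\<lambda>g. \<lambda>h\<in>carrier G. g \<otimes>\<^bsub>G\<^esub> h \<otimes>\<^bsub>G\<^esub> inv\<^bsub>G\<^esub> g)"

definition conj_class :: "('a, 'b) monoid_scheme \<Rightarrow> 'a \<Rightarrow> 'a set" where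
  "conj_class G x = orbit G (conj_action G) x"

definition conj_classes :: "('a, 'b) monoid_scheme \<Rightarrow> 'a set set" where
  "conj_classes G = orbits G (carrier G) (conj_action G)"

definition columns_differ_once :: "('a, 'b) monoid_scheme \<Rightarrow> 'a \<Rightarrow> 'a \<Rightarrow> bool" where
  "columns_differ_once G a b \<longleftrightarrow>
     (\<exists>\<chi>\<in>Irr G. \<chi> a \<noteq> \<chi> b \<and> (\<forall>\<psi>\<in>Irr G. \<psi> \<noteq> \<chi> \<longrightarrow> \<psi> a = \<psi> b))"

definition CD1_group :: "('a, 'b) monoid_scheme \<Rightarrow> bool" where
  "CD1_group G \<longleftrightarrow> group G \<and> finite (carrier G) \<and> Coset.order G > 2 \<and>
     (\<exists>a\<in>carrier G. \<exists>b\<in>carrier G. columns_differ_once G a b)"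

definition special_class :: "('a, 'b) monoid_scheme \<Rightarrow> 'a set \<Rightarrow> bool" where
  "special_class G C \<longleftrightarrow>
     (\<exists>a\<in>carrier G. \<exists>b\<in>carrier G. columns_differ_once G a b \<and>
        (C = conj_class G a \<or> C = conj_class G b))"

end

theory Submission
  imports Defs "Jordan_Normal_Form.Spectral_Radius" "Jordan_Normal_Form.DL_Rank"
begin

text \<open>
Everything rests on two facts about the irreducible characters of a finite group \<open>G\<close>: they are
orthogonal with norm \<open>|G|\<close> under \<open>\<Sum>\<^sub>g cnj (\<chi> g) * \<psi> g\<close> (\<open>Irr_orthogonality\<close>), and only the zero class
function is orthogonal to all of them (\<open>class_function_eq_zero\<close>).

Suppose the columns of \<open>a\<close> and \<open>b\<close> differ in the row of \<open>\<chi>\<close> only. Averaging a character over a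
conjugacy class evaluates it there, so the class function \<open>1\<^sub>A / |A| - 1\<^sub>B / |B|\<close> for the classes \<open>A\<close> of \<open>a\<close>
and \<open>B\<close> of \<open>b\<close> pairs to \<open>0\<close> with every irreducible character other than \<open>\<chi>\<close>. By completeness it is a
multiple of \<open>cnj \<chi>\<close>, and the multiple is nonzero; hence \<open>\<chi>\<close> vanishes outside \<open>A \<union> B\<close>
(\<open>columns_differ_once_vanish\<close>). Since \<open>\<chi> \<one> \<noteq> 0\<close>, one of the two classes is \<open>{\<one>}\<close>. So a CD1-group
has an irreducible character supported on \<open>{\<one>}\<close> and one further class \<open>B\<close>, called a two-class character
below. Conversely, let \<open>\<chi>\<close> be a two-class character of a group with more than two elements. Two
classes cannot exhaust such a group (\<open>order_le_2_if_two_classes\<close>), so \<open>\<chi>\<close> has a zero and is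
nontrivial. Orthogonality to the trivial character gives \<open>\<chi> \<one> = - |B| * \<chi> b\<close>, and
orthogonality to any other \<open>\<psi>\<close> then gives \<open>\<psi> b = \<psi> \<one>\<close> (\<open>two_class_other_constant\<close>). This is part (b).

For part (a), let \<open>\<chi>\<close> be a two-class character with nontrivial class \<open>B\<close>. Comparing
\<open>\<Sum>\<^sub>x |\<psi> x|\<^sup>2 = |G| = \<Sum>\<^sub>x |\<chi> x|\<^sup>2\<close> shows that \<open>\<chi>\<close> has strictly larger degree than every other irreducible
character \<open>\<psi>\<close> (\<open>two_class_degree_maximal\<close>). So \<open>\<chi>\<close> is the last row in any enumeration by degree, and
it is the only two-class character; its support then determines \<open>B\<close>. Finally, a nontrivial normal
subgroup cannot avoid \<open>B\<close>, for then \<open>\<chi>\<close> would vanish on its nonidentity elements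
(\<open>Irr_normal_kernel\<close>). If \<open>B\<close> missed the commutator subgroup, \<open>G\<close> would be abelian, but the
irreducible characters of an abelian group vanish nowhere whereas \<open>\<chi>\<close> does vanish somewhere
(\<open>two_class_derived\<close>).
\<close>

section \<open>Bases adapted to a subspace\<close>

lemma (in vec_space) extend_to_basis_of_subspace:
  assumes W: "VectorSpace.subspace class_ring W V"
    and B: "B \<subseteq> W" "lin_indpt B"
  obtains C where "B \<subseteq> C" "C \<subseteq> W" "finite C" "lin_indpt C" "span C = W"
proof -
  let ?P = "\<lambda>S. B \<subseteq> S \<and> S \<subseteq> W \<and> lin_indpt S"
  have subm: "submodule class_ring W V"
    using W by simp
  then have WV: "W \<subseteq> carrier_vec n"
    by (auto simp: submodule_def)
  have fin: "finite S \<and> card S \<le> n" if "?P S" for S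
    using li_le_dim[OF fin_dim, of S] that WV dim_is_n by auto
  obtain C where C: "finite C" "maximal C ?P"
    using maximal_exists[of ?P n B] fin B by blast
  then have PC: "?P C" by (auto simp: maximal_def)
  have "span C \<subseteq> W"
    using span_is_subset[OF _ subm] PC by blast
  moreover have "w \<in> span C" if w: "w \<in> W" for w
  proof (rule ccontr)
    assume "w \<notin> span C"
    moreover from this have "w \<notin> C" using in_own_span[of C] PC WV by auto
    ultimately have "lin_indpt (C \<union> {w})"
      using lin_dep_iff_in_span[of C w] PC WV w by auto
    then have "?P (C \<union> {w})" using PC w by auto
    then have "C \<union> {w} = C" using C(2) unfolding maximal_def by blast
    with \<open>w \<notin> C\<close> show False by blast
  qed
  ultimately have "span C = W" by (intro subset_antisym) (auto simp only:)
  with that[of C] PC C(1) show ?thesis by simp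
qed

text \<open>The columns of \<open>P\<close> are a basis of \<open>W\<close> followed by an extension to the whole space; multiplication by
\<open>Q\<close> gives coordinates in that basis. In these coordinates an operator preserving \<open>W\<close> becomes block
upper triangular.\<close>

lemma subspace_adapted_basis:
  fixes W :: "complex vec set"
  assumes W: "VectorSpace.subspace class_ring W (module_vec TYPE(complex) n)"
    and nontriv: "W \<noteq> {0\<^sub>v n}" "W \<noteq> carrier_vec n"
  obtains m P Q where "0 < m" "m < n"
    "P \<in> carrier_mat n n" "Q \<in> carrier_mat n n" "Q * P = 1\<^sub>m n" "P * Q = 1\<^sub>m n"
    "\<And>j. j < m \<Longrightarrow> col P j \<in> W"
    "\<And>w i. w \<in> W \<Longrightarrow> m \<le> i \<Longrightarrow> i < n \<Longrightarrow> (Q *\<^sub>v w) $ i = 0"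
proof -
  interpret vec_space "TYPE(complex)" n .
  have li0: "lin_indpt {}"
    by (simp add: finite_lin_indpt2)
  obtain B where B: "B \<subseteq> W" "finite B" "lin_indpt B" "span B = W"
    by (rule extend_to_basis_of_subspace[OF W empty_subsetI li0])
  have subm: "submodule class_ring W V"
    using W by simp
  then have WV: "W \<subseteq> carrier_vec n"
    by (auto simp: submodule_def)
  have "VectorSpace.subspace class_ring (carrier_vec n) V"
    using span_is_subspace[of "set (unit_vecs n)"] span_unit_vecs_is_carrier unit_vecs_carrier by auto
  then obtain C where C: "B \<subseteq> C" "C \<subseteq> carrier_vec n" "finite C" "lin_indpt C"
      "span C = carrier_vec n"
    using extend_to_basis_of_subspace[of "carrier_vec n" B] B(1,3) WV by (metis subset_trans)
  have cardC: "card C = n"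
    using dim_basis[of C] C dim_is_n unfolding basis_def by auto
  obtain bs where bs: "set bs = B" "distinct bs" using finite_distinct_list[OF B(2)] by (elim exE conjE)
  obtain cs where cs: "set cs = C - B" "distinct cs" using finite_distinct_list[of "C - B"] C(3) by (metis finite_Diff)
  let ?m = "length bs"
  let ?us = "bs @ cs"
  have us: "set ?us = C" "distinct ?us" using bs cs C(1) by auto
  then have len: "length ?us = n" using cardC distinct_card by metis
  define P where "P = mat_of_cols n ?us"
  have P: "P \<in> carrier_mat n n" unfolding P_def using len mat_of_cols_carrier(1)[of n ?us] by simp
  have cols: "cols P = ?us" unfolding P_def using us C(2) by (intro cols_mat_of_cols) auto
  have "rank P = n" using lin_indpt_full_rank[OF P] cols us C(4) by simp
  then have "det P \<noteq> 0" using det_rank_iff[OF P] by simp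
  from det_non_zero_imp_unit[OF P this, of "()"]
  obtain Q where Q: "Q \<in> carrier_mat n n" "Q * P = 1\<^sub>m n" "P * Q = 1\<^sub>m n"
    unfolding Units_def ring_mat_simps by auto
  have colP: "col P j = ?us ! j" if "j < n" for j
    using cols that P by (metis cols_nth carrier_matD(2))
  have colB: "col P j \<in> B" if "j < ?m" for j
    using colP[of j] that len bs by (auto simp: nth_append)
  define N where "N = {w \<in> carrier_vec n. \<forall>i. ?m \<le> i \<and> i < n \<longrightarrow> (Q *\<^sub>v w) $ i = 0}"
  have subN: "submodule class_ring N V"
  proof (rule submodule.intro)
    show "Module.module class_ring V" by (rule vec_module)
    show "v \<oplus>\<^bsub>V\<^esub> w \<in> N" if "v \<in> N" "w \<in> N" for v w
      using that Q(1) by (auto simp: N_def scalar_prod_add_distrib[of _ n])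
    show "c \<odot>\<^bsub>V\<^esub> v \<in> N" if "v \<in> N" for c v
      using that Q(1) by (auto simp: N_def mult_mat_vec)
    show "\<zero>\<^bsub>V\<^esub> \<in> N" using Q(1) by (auto simp: N_def)
  qed (auto simp: N_def)
  have "B \<subseteq> N"
  proof
    fix b assume b: "b \<in> B"
    then obtain j where j: "j < ?m" "b = bs ! j" using bs by (metis in_set_conv_nth)
    then have jn: "j < n" using len by simp
    have "b = col P j" using colP[OF jn] j by (simp add: nth_append)
    then have "Q *\<^sub>v b = col (1\<^sub>m n) j"
      using Q P jn by (metis col_mult2)
    then show "b \<in> N" using b j jn B(1) WV by (auto simp: N_def)
  qed
  then have "W \<subseteq> N" using span_is_subset[OF _ subN] B(4) by blast
  then have supp: "(Q *\<^sub>v w) $ i = 0" if "w \<in> W" "?m \<le> i" "i < n" for w i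
    using that by (auto simp: N_def)
  have "?m \<noteq> 0"
  proof
    assume "?m = 0"
    then have "B = {}" using bs by simp
    then have "W = {0\<^sub>v n}" using B(4) span_zero span_empty by simp
    then show False using nontriv by simp
  qed
  moreover have "?m \<noteq> n"
  proof
    assume "?m = n"
    then have "cs = []" using len by simp
    then have "W = carrier_vec n" using cs C(1,5) B(4) by auto
    then show False using nontriv by simp
  qed
  moreover have "?m \<le> n" using len by simp
  ultimately show ?thesis
    using that[of ?m P Q] P Q colB B(1) supp by (metis bot_nat_0.not_eq_extremum le_neq_implies_less subsetD)
qed

lemma subspaceI:
  fixes W :: "complex vec set"
  assumes "W \<subseteq> carrier_vec n" "0\<^sub>v n \<in> W"
    and "\<And>v w. v \<in> W \<Longrightarrow> w \<in> W \<Longrightarrow> v + w \<in> W"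
    and "\<And>c v. v \<in> W \<Longrightarrow> c \<cdot>\<^sub>v v \<in> W"
  shows "VectorSpace.subspace class_ring W (module_vec TYPE(complex) n)"
  using assms vec_vs vec_module
  by (auto simp: VectorSpace.subspace_def submodule_def module_vec_simps)

section \<open>Sums and traces of matrices\<close>

text \<open>Matrices of all sizes form a single type without a common zero, so the dimensions of the sum are
supplied explicitly.\<close>

definition mat_sum :: "nat \<Rightarrow> nat \<Rightarrow> ('i \<Rightarrow> complex mat) \<Rightarrow> 'i set \<Rightarrow> complex mat" where
  "mat_sum nr nc M I = mat nr nc (\<lambda>(i, j). \<Sum>a\<in>I. M a $$ (i, j))"

lemma mat_sum_carrier [simp]: "mat_sum nr nc M I \<in> carrier_mat nr nc"
  by (simp add: mat_sum_def)

lemma mat_sum_index [simp]: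
  "i < nr \<Longrightarrow> j < nc \<Longrightarrow> mat_sum nr nc M I $$ (i, j) = (\<Sum>a\<in>I. M a $$ (i, j))"
  by (simp add: mat_sum_def)

lemma mat_sum_cong:
  assumes "\<And>a. a \<in> I \<Longrightarrow> M a = N a"
  shows "mat_sum nr nc M I = mat_sum nr nc N I"
  using assms by (intro eq_matI) (auto simp: mat_sum_def intro: sum.cong)

lemma mat_sum_reindex_bij_betw:
  assumes "bij_betw h J I"
  shows "mat_sum nr nc (\<lambda>a. M (h a)) J = mat_sum nr nc M I"
  by (intro eq_matI)
    (simp_all add: mat_sum_def sum.reindex_bij_betw[OF assms, of "\<lambda>a. M a $$ ij" for ij])

lemma mult_mat_entry:
  assumes "A \<in> carrier_mat p q" "B \<in> carrier_mat q r" "i < p" "j < r"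
  shows "(A * B) $$ (i, j) = (\<Sum>k<q. A $$ (i, k) * B $$ (k, j))"
  using assms by (auto simp: scalar_prod_def lessThan_atLeast0 intro!: sum.cong)

lemma mult_mat_sum:
  assumes A: "A \<in> carrier_mat p nr" and M: "\<And>a. a \<in> I \<Longrightarrow> M a \<in> carrier_mat nr nc"
  shows "A * mat_sum nr nc M I = mat_sum p nc (\<lambda>a. A * M a) I"
proof (rule eq_matI)
  fix i j assume "i < dim_row (mat_sum p nc (\<lambda>a. A * M a) I)" "j < dim_col (mat_sum p nc (\<lambda>a. A * M a) I)"
  then have ij: "i < p" "j < nc" by (auto simp: mat_sum_def)
  have "(A * mat_sum nr nc M I) $$ (i, j) = (\<Sum>k<nr. A $$ (i, k) * (\<Sum>a\<in>I. M a $$ (k, j)))"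
    using ij by (simp add: mult_mat_entry[OF A mat_sum_carrier] del: index_mult_mat)
  also have "\<dots> = (\<Sum>a\<in>I. \<Sum>k<nr. A $$ (i, k) * M a $$ (k, j))"
    by (subst sum.swap) (simp add: sum_distrib_left)
  also have "\<dots> = (\<Sum>a\<in>I. (A * M a) $$ (i, j))"
    using ij by (intro sum.cong refl) (simp add: mult_mat_entry[OF A M] del: index_mult_mat)
  finally show "(A * mat_sum nr nc M I) $$ (i, j) = mat_sum p nc (\<lambda>a. A * M a) I $$ (i, j)"
    using ij by simp
qed (use A in \<open>auto simp: mat_sum_def\<close>)

lemma mat_sum_mult:
  assumes A: "A \<in> carrier_mat nc q" and M: "\<And>a. a \<in> I \<Longrightarrow> M a \<in> carrier_mat nr nc"
  shows "mat_sum nr nc M I * A = mat_sum nr q (\<lambda>a. M a * A) I"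
proof (rule eq_matI)
  fix i j assume "i < dim_row (mat_sum nr q (\<lambda>a. M a * A) I)" "j < dim_col (mat_sum nr q (\<lambda>a. M a * A) I)"
  then have ij: "i < nr" "j < q" by (auto simp: mat_sum_def)
  have "(mat_sum nr nc M I * A) $$ (i, j) = (\<Sum>k<nc. (\<Sum>a\<in>I. M a $$ (i, k)) * A $$ (k, j))"
    using ij by (simp add: mult_mat_entry[OF mat_sum_carrier A] del: index_mult_mat)
  also have "\<dots> = (\<Sum>a\<in>I. \<Sum>k<nc. M a $$ (i, k) * A $$ (k, j))"
    by (subst sum.swap) (simp add: sum_distrib_right)
  also have "\<dots> = (\<Sum>a\<in>I. (M a * A) $$ (i, j))"
    using ij by (intro sum.cong refl) (simp add: mult_mat_entry[OF M A] del: index_mult_mat)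
  finally show "(mat_sum nr nc M I * A) $$ (i, j) = mat_sum nr q (\<lambda>a. M a * A) I $$ (i, j)"
    using ij by simp
qed (use A in \<open>auto simp: mat_sum_def\<close>)

lemma mat_trace_mat_sum:
  assumes "\<And>a. a \<in> I \<Longrightarrow> M a \<in> carrier_mat n n"
  shows "mat_trace (mat_sum n n M I) = (\<Sum>a\<in>I. mat_trace (M a))"
proof -
  have "mat_trace (mat_sum n n M I) = (\<Sum>i<n. \<Sum>a\<in>I. M a $$ (i, i))"
    by (simp add: mat_trace_def mat_sum_def)
  also have "\<dots> = (\<Sum>a\<in>I. \<Sum>i<n. M a $$ (i, i))" by (rule sum.swap)
  also have "\<dots> = (\<Sum>a\<in>I. mat_trace (M a))"
    using assms by (intro sum.cong) (auto simp: mat_trace_def)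
  finally show ?thesis .
qed

lemma mat_trace_mult_commute:
  assumes "A \<in> carrier_mat n m" "B \<in> carrier_mat m n"
  shows "mat_trace (A * B) = mat_trace (B * A)"
proof -
  have "mat_trace (A * B) = (\<Sum>i<n. \<Sum>k<m. A $$ (i, k) * B $$ (k, i))"
    using assms by (auto simp: mat_trace_def mult_mat_entry[OF assms] simp del: index_mult_mat(1) intro!: sum.cong)
  also have "\<dots> = (\<Sum>k<m. \<Sum>i<n. B $$ (k, i) * A $$ (i, k))"
    by (subst sum.swap) (simp add: mult.commute)
  also have "\<dots> = mat_trace (B * A)"
    using assms by (auto simp: mat_trace_def mult_mat_entry[OF assms(2,1)] simp del: index_mult_mat(1) intro!: sum.cong)
  finally show ?thesis .
qed

text \<open>Here \<open>P\<close> may be rectangular, so that the traces of two representations related by an intertwiner can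
be compared before their dimensions are known to agree.\<close>

lemma mat_trace_conjugate:
  assumes "A \<in> carrier_mat n n" "P \<in> carrier_mat m n" "Q \<in> carrier_mat n m" "Q * P = 1\<^sub>m n"
  shows "mat_trace (P * A * Q) = mat_trace A"
proof -
  have "mat_trace (P * A * Q) = mat_trace (Q * (P * A))"
    using assms by (intro mat_trace_mult_commute[of _ m n]) auto
  also have "Q * (P * A) = A"
    using assms by (simp flip: assoc_mult_mat)
  finally show ?thesis .
qed

lemma mat_trace_smult: "mat_trace (c \<cdot>\<^sub>m A) = c * mat_trace A" if "A \<in> carrier_mat n n"
  using that by (auto simp: mat_trace_def sum_distrib_left)

lemma mat_trace_one: "mat_trace (1\<^sub>m n) = of_nat n"
  by (simp add: mat_trace_def)

lemma mat_eq_zeroI: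
  assumes A: "A \<in> carrier_mat n m" and "\<And>v. v \<in> carrier_vec m \<Longrightarrow> A *\<^sub>v v = 0\<^sub>v n"
  shows "A = (0\<^sub>m n m :: complex mat)"
proof (rule eq_matI)
  fix i j assume "i < dim_row (0\<^sub>m n m)" "j < dim_col (0\<^sub>m n m)"
  then have ij: "i < n" "j < m" by auto
  then have "A $$ (i, j) = (A *\<^sub>v unit_vec m j) $ i" using A by simp
  also have "\<dots> = 0" using assms(2)[of "unit_vec m j"] ij by simp
  finally show "A $$ (i, j) = 0\<^sub>m n m $$ (i, j)" using ij by simp
qed (use A in auto)

definition unit_mat :: "nat \<Rightarrow> nat \<Rightarrow> nat \<Rightarrow> nat \<Rightarrow> complex mat" where
  "unit_mat n m i j = mat n m (\<lambda>(k, l). if k = i \<and> l = j then 1 else 0)"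

lemma unit_mat_carrier [simp]: "unit_mat n m i j \<in> carrier_mat n m"
  by (simp add: unit_mat_def)

text \<open>Averaging matrix units extracts products of diagonal entries, whose sum is a product of traces.\<close>

lemma unit_mat_sandwich:
  assumes A: "A \<in> carrier_mat n n" and B: "B \<in> carrier_mat m m" and "i < n" "j < m"
  shows "(A * unit_mat n m i j * B) $$ (i, j) = A $$ (i, i) * B $$ (j, j)"
proof -
  have AE: "A * unit_mat n m i j \<in> carrier_mat n m" using A by auto
  have "(A * unit_mat n m i j) $$ (i, l) = (if l = j then A $$ (i, i) else 0)" if "l < m" for l
  proof -
    have "(A * unit_mat n m i j) $$ (i, l) = (\<Sum>k<n. if k = i then (if l = j then A $$ (i, k) else 0) else 0)"
      unfolding mult_mat_entry[OF A unit_mat_carrier \<open>i < n\<close> that]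
      using that by (intro sum.cong) (auto simp: unit_mat_def)
    then show ?thesis using \<open>i < n\<close> by (simp add: sum.delta)
  qed
  then have "(A * unit_mat n m i j * B) $$ (i, j) = (\<Sum>l<m. if l = j then A $$ (i, i) * B $$ (l, j) else 0)"
    unfolding mult_mat_entry[OF AE B \<open>i < n\<close> \<open>j < m\<close>] by (intro sum.cong) auto
  then show ?thesis using \<open>j < m\<close> by (simp add: sum.delta)
qed

section \<open>Schur's lemma\<close>

context group
begin

lemma group_representationI:
  assumes "\<And>g. g \<in> carrier G \<Longrightarrow> \<rho> g \<in> carrier_mat n n"
    and one: "\<rho> \<one> = 1\<^sub>m n"
    and mult: "\<And>g h. g \<in> carrier G \<Longrightarrow> h \<in> carrier G \<Longrightarrow> \<rho> (g \<otimes> h) = \<rho> g * \<rho> h"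
  shows "group_representation G n \<rho>"
  unfolding group_representation_def
proof (rule homI)
  fix g assume g: "g \<in> carrier G"
  have "\<rho> g * \<rho> (inv g) = 1\<^sub>m n" "\<rho> (inv g) * \<rho> g = 1\<^sub>m n"
    using g by (simp_all flip: mult add: one)
  then show "\<rho> g \<in> carrier (units_of (ring_mat TYPE(complex) n ()))"
    using assms(1)[OF g] assms(1)[of "inv g"] g
    by (auto simp: units_of_def Units_def ring_mat_simps)
qed (simp add: units_of_def ring_mat_simps mult)

context
  fixes n \<rho>
  assumes rep: "group_representation G n \<rho>"
begin

lemma rep_carrier [intro]: "g \<in> carrier G \<Longrightarrow> \<rho> g \<in> carrier_mat n n"
  using rep by (auto simp: group_representation_def hom_def units_of_def Units_def ring_mat_simps)

lemma rep_mult: "g \<in> carrier G \<Longrightarrow> h \<in> carrier G \<Longrightarrow> \<rho> (g \<otimes> h) = \<rho> g * \<rho> h"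
  using rep by (auto simp: group_representation_def hom_def units_of_def ring_mat_simps)

lemma rep_one: "\<rho> \<one> = 1\<^sub>m n"
proof -
  interpret M: ring "ring_mat TYPE(complex) n ()" by (rule ring_mat)
  have "group_hom G (units_of (ring_mat TYPE(complex) n ())) \<rho>"
    using rep M.units_group
    by (auto simp: group_hom_def group_hom_axioms_def group_representation_def is_group)
  then show ?thesis
    using group_hom.hom_one by (fastforce simp: units_of_def ring_mat_simps)
qed

lemma rep_inv_right: "g \<in> carrier G \<Longrightarrow> \<rho> g * \<rho> (inv g) = 1\<^sub>m n"
  and rep_inv_left: "g \<in> carrier G \<Longrightarrow> \<rho> (inv g) * \<rho> g = 1\<^sub>m n"
  by (simp_all flip: rep_mult add: rep_one)

end

lemma irreducible_imp_rep: "irreducible_representation G n \<rho> \<Longrightarrow> group_representation G n \<rho>"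
  by (simp add: irreducible_representation_def)

lemma irreducible_invariant_subspace:
  assumes irr: "irreducible_representation G n \<rho>"
    and W: "W \<subseteq> carrier_vec n" "0\<^sub>v n \<in> W"
    "\<And>v w. v \<in> W \<Longrightarrow> w \<in> W \<Longrightarrow> v + w \<in> W"
    "\<And>c v. v \<in> W \<Longrightarrow> c \<cdot>\<^sub>v v \<in> W"
    and inv: "\<And>g w. g \<in> carrier G \<Longrightarrow> w \<in> W \<Longrightarrow> \<rho> g *\<^sub>v w \<in> W"
  shows "W = {0\<^sub>v n} \<or> W = carrier_vec n"
  using irr subspaceI[OF W] inv unfolding irreducible_representation_def by blast

text \<open>The kernel and the range of \<open>T\<close> are invariant subspaces, so the kernel is zero and the range is
everything. A right inverse \<open>S\<close> is assembled from preimages of the unit vectors; it is also a left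
inverse because \<open>T\<close> kills \<open>S * (T * v) - v\<close>.\<close>

lemma schur_intertwiner_invertible:
  assumes irr\<rho>: "irreducible_representation G m \<rho>" and irr\<sigma>: "irreducible_representation G n \<sigma>"
    and T: "T \<in> carrier_mat n m" "T \<noteq> 0\<^sub>m n m"
    and comm: "\<And>g. g \<in> carrier G \<Longrightarrow> \<sigma> g * T = T * \<rho> g"
  obtains S where "S \<in> carrier_mat m n" "T * S = 1\<^sub>m n" "S * T = 1\<^sub>m m"
proof -
  note [intro] = rep_carrier[OF irreducible_imp_rep[OF irr\<rho>]] rep_carrier[OF irreducible_imp_rep[OF irr\<sigma>]]
  have commv: "\<sigma> g *\<^sub>v (T *\<^sub>v v) = T *\<^sub>v (\<rho> g *\<^sub>v v)" if "g \<in> carrier G" "v \<in> carrier_vec m" for g v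
    using that T comm[OF that(1)] by (metis assoc_mult_mat_vec rep_carrier irreducible_imp_rep irr\<rho> irr\<sigma>)
  let ?K = "{v \<in> carrier_vec m. T *\<^sub>v v = 0\<^sub>v n}"
  have "?K = {0\<^sub>v m} \<or> ?K = carrier_vec m"
  proof (rule irreducible_invariant_subspace[OF irr\<rho>])
    fix g w assume gw: "g \<in> carrier G" "w \<in> ?K"
    then have "T *\<^sub>v (\<rho> g *\<^sub>v w) = \<sigma> g *\<^sub>v 0\<^sub>v n"
      using commv[of g w] by simp
    also have "\<dots> = 0\<^sub>v n"
      using rep_carrier[OF irreducible_imp_rep[OF irr\<sigma>] gw(1)] by (intro eq_vecI) auto
    finally show "\<rho> g *\<^sub>v w \<in> ?K"
      using gw rep_carrier[OF irreducible_imp_rep[OF irr\<rho>] gw(1)] by auto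
  qed (use T in \<open>auto simp: mult_add_distrib_mat_vec mult_mat_vec\<close>)
  moreover have "?K \<noteq> carrier_vec m"
    using mat_eq_zeroI[OF T(1)] T(2) by blast
  ultimately have ker: "?K = {0\<^sub>v m}" by blast
  let ?R = "{T *\<^sub>v v | v. v \<in> carrier_vec m}"
  have "?R = {0\<^sub>v n} \<or> ?R = carrier_vec n"
  proof (rule irreducible_invariant_subspace[OF irr\<sigma>])
    show "?R \<subseteq> carrier_vec n" using T by auto
    show "0\<^sub>v n \<in> ?R" using T by (auto intro!: exI[of _ "0\<^sub>v m"])
    show "v + w \<in> ?R" if "v \<in> ?R" "w \<in> ?R" for v w
      using that T(1) by (auto simp flip: mult_add_distrib_mat_vec)
    show "c \<cdot>\<^sub>v v \<in> ?R" if "v \<in> ?R" for c v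
      using that T(1) by (auto simp flip: mult_mat_vec)
    show "\<sigma> g *\<^sub>v w \<in> ?R" if gw: "g \<in> carrier G" "w \<in> ?R" for g w
    proof -
      obtain v where v: "v \<in> carrier_vec m" "w = T *\<^sub>v v" using gw(2) by blast
      have "\<sigma> g *\<^sub>v w = T *\<^sub>v (\<rho> g *\<^sub>v v)" using commv[OF gw(1) v(1)] v(2) by simp
      moreover have "\<rho> g *\<^sub>v v \<in> carrier_vec m"
        using rep_carrier[OF irreducible_imp_rep[OF irr\<rho>] gw(1)] v(1) by simp
      ultimately show ?thesis by blast
    qed
  qed
  moreover have "?R \<noteq> {0\<^sub>v n}"
    using mat_eq_zeroI[OF T(1)] T(2) by blast
  ultimately have im: "?R = carrier_vec n" by blast
  have "\<exists>v. v \<in> carrier_vec m \<and> T *\<^sub>v v = unit_vec n j" for j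
  proof -
    have "unit_vec n j \<in> ?R" unfolding im by simp
    then show ?thesis by (smt (verit) mem_Collect_eq)
  qed
  then obtain s where s: "\<And>j. s j \<in> carrier_vec m" "\<And>j. T *\<^sub>v s j = unit_vec n j" by metis
  define S where "S = mat_of_cols m (map s [0..<n])"
  have S: "S \<in> carrier_mat m n" unfolding S_def by (simp add: mat_of_cols_def)
  have colS: "col S j = s j" if "j < n" for j
    using that s(1) unfolding S_def by (subst col_mat_of_cols) auto
  have TS: "T * S = 1\<^sub>m n"
  proof (rule mat_col_eqI)
    show "col (T * S) j = col (1\<^sub>m n) j" if "j < dim_col (1\<^sub>m n)" for j
      using that col_mult2[OF T(1) S, of j] by (simp add: colS s(2))
  qed (use T S in auto)
  have "S * T - 1\<^sub>m m = 0\<^sub>m m m"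
  proof (rule mat_eq_zeroI)
    show "S * T - 1\<^sub>m m \<in> carrier_mat m m" using S T by auto
    fix v :: "complex vec" assume v: "v \<in> carrier_vec m"
    have ST: "S * T \<in> carrier_mat m m" and Tv: "T *\<^sub>v v \<in> carrier_vec n" using S T v by auto
    have eq: "(S * T - 1\<^sub>m m) *\<^sub>v v = S *\<^sub>v (T *\<^sub>v v) - v"
      using v ST by (simp add: minus_mult_distrib_mat_vec[OF ST _ v] assoc_mult_mat_vec[OF S T(1) v])
    have "T *\<^sub>v (S *\<^sub>v (T *\<^sub>v v) - v) = (T * S) *\<^sub>v (T *\<^sub>v v) - T *\<^sub>v v"
      using mult_minus_distrib_mat_vec[OF T(1) _ v, of "S *\<^sub>v (T *\<^sub>v v)"] S Tv
        assoc_mult_mat_vec[OF T(1) S Tv] by auto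
    also have "\<dots> = 0\<^sub>v n" using Tv by (simp add: TS)
    finally have "S *\<^sub>v (T *\<^sub>v v) - v \<in> ?K" using S T v by auto
    then show "(S * T - 1\<^sub>m m) *\<^sub>v v = 0\<^sub>v m" unfolding eq ker by simp
  qed
  then have ST: "S * T = 1\<^sub>m m"
  proof (intro eq_matI)
    fix i j assume "i < dim_row (1\<^sub>m m)" "j < dim_col (1\<^sub>m m)"
    moreover assume "S * T - 1\<^sub>m m = 0\<^sub>m m m"
    from arg_cong[OF this, of "\<lambda>A. A $$ (i, j)"]
    have "i < m \<Longrightarrow> j < m \<Longrightarrow> (S * T) $$ (i, j) - 1\<^sub>m m $$ (i, j) = 0"
      using S T by simp
    ultimately show "(S * T) $$ (i, j) = 1\<^sub>m m $$ (i, j)" by simp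
  qed (use S T in auto)
  show ?thesis using that S TS ST by blast
qed

text \<open>Over the complex numbers \<open>T\<close> has an eigenvalue \<open>c\<close>, and \<open>T - c\<close> is a noninvertible self-intertwiner,
hence zero.\<close>

lemma schur_scalar:
  assumes irr: "irreducible_representation G n \<rho>" and T: "T \<in> carrier_mat n n"
    and comm: "\<And>g. g \<in> carrier G \<Longrightarrow> \<rho> g * T = T * \<rho> g"
  obtains c where "T = c \<cdot>\<^sub>m 1\<^sub>m n"
proof -
  have "n > 0" using irr by (simp add: irreducible_representation_def)
  then obtain c where "eigenvalue T c"
    using spectrum_non_empty[OF T] by (auto simp: spectrum_def)
  then obtain v where v: "v \<in> carrier_vec n" "v \<noteq> 0\<^sub>v n" "T *\<^sub>v v = c \<cdot>\<^sub>v v"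
    using T by (auto simp: eigenvalue_def eigenvector_def)
  define U where "U = T - c \<cdot>\<^sub>m 1\<^sub>m n"
  have U: "U \<in> carrier_mat n n" unfolding U_def by (intro minus_carrier_mat) simp
  have cv: "(c \<cdot>\<^sub>m 1\<^sub>m n) *\<^sub>v v = c \<cdot>\<^sub>v v"
    using v(1) by (intro eq_vecI) auto
  have Uv: "U *\<^sub>v v = 0\<^sub>v n"
    using T v cv by (simp add: U_def minus_mult_distrib_mat_vec[of _ n n])
  have "U = 0\<^sub>m n n"
  proof (rule ccontr)
    assume nz: "U \<noteq> 0\<^sub>m n n"
    have "\<rho> g * U = U * \<rho> g" if g: "g \<in> carrier G" for g
    proof -
      have R: "\<rho> g \<in> carrier_mat n n" by (rule rep_carrier[OF irreducible_imp_rep[OF irr] g])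
      have "\<rho> g * (c \<cdot>\<^sub>m 1\<^sub>m n) = c \<cdot>\<^sub>m 1\<^sub>m n * \<rho> g"
        using R by (simp add: mult_smult_distrib[OF R one_carrier_mat] mult_smult_assoc_mat[OF one_carrier_mat R])
      then show ?thesis
        using R T comm[OF g]
        by (simp add: U_def mult_minus_distrib_mat[of _ n n] minus_mult_distrib_mat[of _ n n])
    qed
    then obtain S where S: "S \<in> carrier_mat n n" "S * U = 1\<^sub>m n"
      using schur_intertwiner_invertible[OF irr irr U nz] by blast
    have "v = (S * U) *\<^sub>v v" using v S by simp
    also have "\<dots> = 0\<^sub>v n"
      using S(1) by (simp add: assoc_mult_mat_vec[OF S(1) U v(1)] Uv) (intro eq_vecI, auto)
    finally show False using v by simp
  qed
  have "T = c \<cdot>\<^sub>m 1\<^sub>m n"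
  proof (rule eq_matI)
    fix i j assume "i < dim_row (c \<cdot>\<^sub>m 1\<^sub>m n)" "j < dim_col (c \<cdot>\<^sub>m 1\<^sub>m n)"
    then have ij: "i < n" "j < n" by auto
    have "U $$ (i, j) = 0" using \<open>U = 0\<^sub>m n n\<close> ij by simp
    then show "T $$ (i, j) = (c \<cdot>\<^sub>m 1\<^sub>m n) $$ (i, j)" using T ij by (simp add: U_def)
  qed (use T in auto)
  then show ?thesis by (rule that)
qed

section \<open>Orthogonality of characters\<close>

lemma bij_betw_left_mult: "h \<in> carrier G \<Longrightarrow> bij_betw (\<lambda>g. h \<otimes> g) (carrier G) (carrier G)"
  by (rule bij_betw_byWitness[where f' = "\<lambda>g. inv h \<otimes> g"]) (auto simp flip: m_assoc)

lemma bij_betw_right_mult: "h \<in> carrier G \<Longrightarrow> bij_betw (\<lambda>g. g \<otimes> h) (carrier G) (carrier G)"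
  by (rule bij_betw_byWitness[where f' = "\<lambda>g. g \<otimes> inv h"]) (auto simp: m_assoc)

lemma bij_betw_conj: "h \<in> carrier G \<Longrightarrow> bij_betw (\<lambda>g. h \<otimes> g \<otimes> inv h) (carrier G) (carrier G)"
  using bij_betw_trans[OF bij_betw_left_mult[of h] bij_betw_right_mult[of "inv h"]] by (simp add: comp_def)

lemma rep_trace_conj:
  assumes rep: "group_representation G n \<rho>" and "g \<in> carrier G" "x \<in> carrier G"
  shows "mat_trace (\<rho> (g \<otimes> x \<otimes> inv g)) = mat_trace (\<rho> x)"
proof -
  have "\<rho> (g \<otimes> x \<otimes> inv g) = \<rho> g * \<rho> x * \<rho> (inv g)"
    using assms by (simp add: rep_mult[OF rep])
  then show ?thesis
    using assms rep_inv_left[OF rep]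
    by (simp add: mat_trace_conjugate[OF rep_carrier[OF rep] rep_carrier[OF rep] rep_carrier[OF rep]])
qed

text \<open>The Hermitian form \<open>H\<close> obtained by averaging the standard form over the group is invariant and
nondegenerate, so \<open>\<rho> (inv g)\<close> is similar, via \<open>H\<close>, to the conjugate transpose of \<open>\<rho> g\<close>.\<close>

lemma rep_trace_inv:
  assumes fin: "finite (carrier G)" and rep: "group_representation G n \<rho>" and g: "g \<in> carrier G"
  shows "mat_trace (\<rho> (inv g)) = cnj (mat_trace (\<rho> g))"
proof -
  define adj where "adj A = mat (dim_col A) (dim_row A) (\<lambda>(i, j). cnj (A $$ (j, i)))" for A
  have adj_carrier: "adj A \<in> carrier_mat q p" if "A \<in> carrier_mat p q" for A p q
    using that by (simp add: adj_def)
  have adj_mult: "adj (A * B) = adj B * adj A" if "A \<in> carrier_mat n n" "B \<in> carrier_mat n n" for A B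
  proof (rule eq_matI)
    fix i j assume "i < dim_row (adj B * adj A)" "j < dim_col (adj B * adj A)"
    then have ij: "i < n" "j < n" using that by (auto simp: adj_def)
    then show "adj (A * B) $$ (i, j) = (adj B * adj A) $$ (i, j)"
      using that mult_mat_entry[OF that ij(2,1)]
        mult_mat_entry[OF adj_carrier[OF that(2)] adj_carrier[OF that(1)] ij]
      by (simp add: adj_def mult.commute del: index_mult_mat(1))
  qed (use that in \<open>auto simp: adj_def\<close>)
  note R [intro] = rep_carrier[OF rep]
  define H where "H = mat_sum n n (\<lambda>h. adj (\<rho> h) * \<rho> h) (carrier G)"
  have H: "H \<in> carrier_mat n n" by (simp add: H_def)
  have aR [intro]: "adj (\<rho> h) \<in> carrier_mat n n" if "h \<in> carrier G" for h
    using R[OF that] by (rule adj_carrier)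
  have inv: "adj (\<rho> g) * H * \<rho> g = H"
  proof -
    have "adj (\<rho> g) * H * \<rho> g = mat_sum n n (\<lambda>h. adj (\<rho> g) * (adj (\<rho> h) * \<rho> h) * \<rho> g) (carrier G)"
      unfolding H_def using g R aR
      by (subst mult_mat_sum[of _ n], auto intro!: mult_carrier_mat, subst mat_sum_mult[of _ n n], auto intro!: mult_carrier_mat)
    also have "\<dots> = mat_sum n n (\<lambda>h. adj (\<rho> (h \<otimes> g)) * \<rho> (h \<otimes> g)) (carrier G)"
    proof (rule mat_sum_cong)
      fix h assume h: "h \<in> carrier G"
      have "adj (\<rho> g) * (adj (\<rho> h) * \<rho> h) * \<rho> g = adj (\<rho> g) * adj (\<rho> h) * (\<rho> h * \<rho> g)"
        using R[OF h] R[OF g] aR[OF h] aR[OF g]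
        by (smt (verit) assoc_mult_mat mult_carrier_mat)
      then show "adj (\<rho> g) * (adj (\<rho> h) * \<rho> h) * \<rho> g = adj (\<rho> (h \<otimes> g)) * \<rho> (h \<otimes> g)"
        using g h by (simp add: rep_mult[OF rep] adj_mult[OF R R])
    qed
    also have "\<dots> = H"
      unfolding H_def by (rule mat_sum_reindex_bij_betw[OF bij_betw_right_mult[OF g]])
    finally show ?thesis .
  qed
  \<comment> \<open>If \<open>H v = 0\<close>, pairing with \<open>v\<close> writes \<open>0\<close> as the sum of all \<open>|\<rho> h v|\<^sup>2\<close>; the term of \<open>h = \<one>\<close> is \<open>|v|\<^sup>2\<close>.\<close>
  have "det H \<noteq> 0"
  proof
    assume "det H = 0"
    then obtain v where v: "v \<in> carrier_vec n" "v \<noteq> 0\<^sub>v n" "H *\<^sub>v v = 0\<^sub>v n"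
      using det_0_iff_vec_prod_zero_field[OF H] by blast
    define y where "y h k = (\<Sum>j<n. \<rho> h $$ (k, j) * v $ j)" for h k
    have Hv: "(H *\<^sub>v v) $ i = (\<Sum>j<n. H $$ (i, j) * v $ j)" if "i < n" for i
      using that H v(1) by (auto simp: scalar_prod_def lessThan_atLeast0 intro!: sum.cong)
    have Hij: "H $$ (i, j) = (\<Sum>h\<in>carrier G. \<Sum>k<n. cnj (\<rho> h $$ (k, i)) * \<rho> h $$ (k, j))"
      if ij: "i < n" "j < n" for i j
      unfolding H_def mat_sum_index[OF ij]
    proof (intro sum.cong refl)
      fix h assume h: "h \<in> carrier G"
      show "(adj (\<rho> h) * \<rho> h) $$ (i, j) = (\<Sum>k<n. cnj (\<rho> h $$ (k, i)) * \<rho> h $$ (k, j))"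
        unfolding mult_mat_entry[OF aR[OF h] R[OF h] ij]
        using R[OF h] ij by (intro sum.cong) (auto simp: adj_def)
    qed
    have "0 = (\<Sum>i<n. cnj (v $ i) * (H *\<^sub>v v) $ i)" using v(3) by simp
    also have "\<dots> = (\<Sum>i<n. \<Sum>j<n. \<Sum>h\<in>carrier G. \<Sum>k<n.
        cnj (\<rho> h $$ (k, i) * v $ i) * (\<rho> h $$ (k, j) * v $ j))"
      by (intro sum.cong refl) (simp add: Hv Hij sum_distrib_left sum_distrib_right mult_ac)
    also have "\<dots> = (\<Sum>h\<in>carrier G. \<Sum>k<n. \<Sum>i<n. \<Sum>j<n.
        cnj (\<rho> h $$ (k, i) * v $ i) * (\<rho> h $$ (k, j) * v $ j))"
      by (subst (2) sum.swap, subst sum.swap, intro sum.cong refl,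
          subst (2) sum.swap, rule sum.swap)
    also have "\<dots> = (\<Sum>h\<in>carrier G. \<Sum>k<n. cnj (y h k) * y h k)"
      by (simp add: y_def sum_product)
    also have "\<dots> = of_real (\<Sum>h\<in>carrier G. \<Sum>k<n. (cmod (y h k))\<^sup>2)"
      by (simp add: complex_norm_square mult.commute del: of_real_power)
    finally have "(\<Sum>h\<in>carrier G. \<Sum>k<n. (cmod (y h k))\<^sup>2) = 0"
      by (metis of_real_eq_0_iff)
    then have "(\<Sum>k<n. (cmod (y \<one> k))\<^sup>2) = 0"
      using fin by (subst (asm) sum_nonneg_eq_0_iff) (auto intro: sum_nonneg)
    then have "y \<one> k = 0" if "k < n" for k
      using that by (subst (asm) sum_nonneg_eq_0_iff) auto
    moreover have "y \<one> k = v $ k" if "k < n" for k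
      using that by (simp add: y_def rep_one[OF rep] if_distrib[of "\<lambda>x. x * _"] sum.delta cong: if_cong)
    ultimately have "v = 0\<^sub>v n" using v(1) by (intro eq_vecI) auto
    with v(2) show False by simp
  qed
  from det_non_zero_imp_unit[OF H this, of "()"]
  obtain K where K: "K \<in> carrier_mat n n" "K * H = 1\<^sub>m n" "H * K = 1\<^sub>m n"
    unfolding Units_def ring_mat_simps by auto
  have gi: "inv g \<in> carrier G" using g by simp
  have "H * \<rho> (inv g) = adj (\<rho> g) * H * \<rho> g * \<rho> (inv g)" by (simp add: inv)
  also have "\<dots> = adj (\<rho> g) * H"
    using aR[OF g] H R[OF g] R[OF gi] rep_inv_right[OF rep g]
    by (simp add: assoc_mult_mat[of _ n n _ n _ n] mult_carrier_mat[of _ n n _ n])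
  finally have eq: "H * \<rho> (inv g) = adj (\<rho> g) * H" .
  have "H * \<rho> (inv g) * K = adj (\<rho> g)"
    unfolding eq using aR[OF g] H K by (simp add: assoc_mult_mat[of _ n n])
  then have "mat_trace (\<rho> (inv g)) = mat_trace (adj (\<rho> g))"
    using mat_trace_conjugate[OF R[OF gi] H K(1,2)] by simp
  also have "\<dots> = cnj (mat_trace (\<rho> g))"
    using R[OF g] by (simp add: mat_trace_def adj_def)
  finally show ?thesis .
qed

lemma averaged_intertwiner:
  assumes rep\<rho>: "group_representation G m \<rho>" and rep\<sigma>: "group_representation G n \<sigma>"
    and E: "E \<in> carrier_mat n m" and h: "h \<in> carrier G"
  defines "T \<equiv> mat_sum n m (\<lambda>g. \<sigma> g * E * \<rho> (inv g)) (carrier G)"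
  shows "\<sigma> h * T = T * \<rho> h"
proof -
  note R = rep_carrier[OF rep\<rho>] and S = rep_carrier[OF rep\<sigma>]
  have M: "\<sigma> g * E * \<rho> (inv g) \<in> carrier_mat n m" if "g \<in> carrier G" for g
    using S[OF that] R[of "inv g"] that E by auto
  have "T * \<rho> h = mat_sum n m (\<lambda>g. \<sigma> g * E * \<rho> (inv g) * \<rho> h) (carrier G)"
    unfolding T_def by (rule mat_sum_mult[OF R[OF h] M])
  also have "\<dots> = mat_sum n m (\<lambda>g. \<sigma> (h \<otimes> g) * E * \<rho> (inv (h \<otimes> g)) * \<rho> h) (carrier G)"
    by (rule mat_sum_reindex_bij_betw[OF bij_betw_left_mult[OF h], symmetric])
  also have "\<dots> = mat_sum n m (\<lambda>g. \<sigma> h * (\<sigma> g * E * \<rho> (inv g))) (carrier G)"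
  proof (rule mat_sum_cong)
    fix g assume g: "g \<in> carrier G"
    have gi: "inv g \<in> carrier G" and hi: "inv h \<in> carrier G" using g h by auto
    have X: "\<sigma> h * \<sigma> g * E \<in> carrier_mat n m" using S[OF h] S[OF g] E by auto
    have "\<sigma> (h \<otimes> g) * E * \<rho> (inv (h \<otimes> g)) * \<rho> h
        = \<sigma> h * \<sigma> g * E * (\<rho> (inv g) * \<rho> (inv h)) * \<rho> h"
      using g h by (simp add: inv_mult_group rep_mult[OF rep\<rho>] rep_mult[OF rep\<sigma>])
    also have "\<dots> = \<sigma> h * \<sigma> g * E * (\<rho> (inv g) * (\<rho> (inv h) * \<rho> h))"
      using assoc_mult_mat[OF X mult_carrier_mat[OF R[OF gi] R[OF hi]] R[OF h]]
        assoc_mult_mat[OF R[OF gi] R[OF hi] R[OF h]] by simp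
    also have "\<dots> = \<sigma> h * (\<sigma> g * E * \<rho> (inv g))"
      using assoc_mult_mat[OF S[OF h] S[OF g] E] R[OF gi] rep_inv_left[OF rep\<rho> h]
        assoc_mult_mat[OF S[OF h] mult_carrier_mat[OF S[OF g] E] R[OF gi]] by simp
    finally show "\<sigma> (h \<otimes> g) * E * \<rho> (inv (h \<otimes> g)) * \<rho> h = \<sigma> h * (\<sigma> g * E * \<rho> (inv g))" .
  qed
  also have "\<dots> = \<sigma> h * T"
    unfolding T_def by (rule mult_mat_sum[OF S[OF h] M, symmetric])
  finally show ?thesis by simp
qed

text \<open>The pairing of two characters is a sum of entries of averaged intertwiners, to which Schur's lemma
applies.\<close>

lemma sum_rep_traces_eq_averaged:
  assumes rep\<rho>: "group_representation G m \<rho>" and rep\<sigma>: "group_representation G n \<sigma>"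
  shows "(\<Sum>g\<in>carrier G. mat_trace (\<sigma> g) * mat_trace (\<rho> (inv g))) =
    (\<Sum>i<n. \<Sum>j<m. mat_sum n m (\<lambda>g. \<sigma> g * unit_mat n m i j * \<rho> (inv g)) (carrier G) $$ (i, j))"
proof -
  have "(\<Sum>g\<in>carrier G. mat_trace (\<sigma> g) * mat_trace (\<rho> (inv g)))
      = (\<Sum>g\<in>carrier G. \<Sum>i<n. \<Sum>j<m. \<sigma> g $$ (i, i) * \<rho> (inv g) $$ (j, j))"
    using rep_carrier[OF rep\<rho>] rep_carrier[OF rep\<sigma>]
    by (intro sum.cong refl) (simp add: mat_trace_def sum_product carrier_matD(1)[OF rep_carrier[OF rep\<rho>]]
      carrier_matD(1)[OF rep_carrier[OF rep\<sigma>]])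
  also have "\<dots> = (\<Sum>i<n. \<Sum>j<m. \<Sum>g\<in>carrier G. \<sigma> g $$ (i, i) * \<rho> (inv g) $$ (j, j))"
    by (subst sum.swap, intro sum.cong refl, rule sum.swap)
  also have "\<dots> = (\<Sum>i<n. \<Sum>j<m. mat_sum n m (\<lambda>g. \<sigma> g * unit_mat n m i j * \<rho> (inv g)) (carrier G) $$ (i, j))"
    using rep_carrier[OF rep\<rho>] rep_carrier[OF rep\<sigma>]
    by (intro sum.cong refl) (simp add: unit_mat_sandwich del: index_mult_mat)
  finally show ?thesis .
qed

text \<open>A nonzero averaged intertwiner would be invertible and make the two representations, hence their
traces, agree; so all averages vanish.\<close>

lemma schur_orthogonality:
  assumes irr\<rho>: "irreducible_representation G m \<rho>" and irr\<sigma>: "irreducible_representation G n \<sigma>"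
    and ne: "\<exists>g\<in>carrier G. mat_trace (\<rho> g) \<noteq> mat_trace (\<sigma> g)"
  shows "(\<Sum>g\<in>carrier G. mat_trace (\<sigma> g) * mat_trace (\<rho> (inv g))) = 0"
proof -
  note rep\<rho> = irreducible_imp_rep[OF irr\<rho>] and rep\<sigma> = irreducible_imp_rep[OF irr\<sigma>]
  have "mat_sum n m (\<lambda>g. \<sigma> g * unit_mat n m i j * \<rho> (inv g)) (carrier G) = 0\<^sub>m n m" (is "?T = _") for i j
  proof (rule ccontr)
    assume nz: "?T \<noteq> 0\<^sub>m n m"
    have T: "?T \<in> carrier_mat n m" by simp
    have comm: "\<sigma> g * ?T = ?T * \<rho> g" if "g \<in> carrier G" for g
      using averaged_intertwiner[OF rep\<rho> rep\<sigma> unit_mat_carrier that] .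
    obtain S where S: "S \<in> carrier_mat m n" "?T * S = 1\<^sub>m n" "S * ?T = 1\<^sub>m m"
      using schur_intertwiner_invertible[OF irr\<rho> irr\<sigma> T nz comm] by blast
    have "mat_trace (\<rho> g) = mat_trace (\<sigma> g)" if g: "g \<in> carrier G" for g
    proof -
      have "?T * \<rho> g * S = \<sigma> g * (?T * S)"
        unfolding comm[OF g, symmetric] by (rule assoc_mult_mat[OF rep_carrier[OF rep\<sigma> g] T S(1)])
      then have "?T * \<rho> g * S = \<sigma> g" using S(2) rep_carrier[OF rep\<sigma> g] by simp
      then show ?thesis
        using mat_trace_conjugate[OF rep_carrier[OF rep\<rho> g] T S(1,3)] by simp
    qed
    with ne show False by blast
  qed
  then show ?thesis
    unfolding sum_rep_traces_eq_averaged[OF rep\<rho> rep\<sigma>] by simp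
qed

text \<open>The average of a matrix unit is a scalar matrix, and its trace, which averaging multiplies by \<open>|G|\<close>,
determines the scalar.\<close>

lemma schur_norm:
  assumes fin: "finite (carrier G)" and irr: "irreducible_representation G n \<rho>"
  shows "(\<Sum>g\<in>carrier G. mat_trace (\<rho> g) * mat_trace (\<rho> (inv g))) = of_nat (Coset.order G)"
proof -
  note rep = irreducible_imp_rep[OF irr]
  have n: "n > 0" using irr by (simp add: irreducible_representation_def)
  have entry: "mat_sum n n (\<lambda>g. \<rho> g * unit_mat n n i j * \<rho> (inv g)) (carrier G) $$ (i, j)
      = (if i = j then of_nat (Coset.order G) / of_nat n else 0)" (is "?T $$ _ = _") if ij: "i < n" "j < n" for i j
  proof -
    have "?T \<in> carrier_mat n n" by simp
    moreover have "\<rho> g * ?T = ?T * \<rho> g" if "g \<in> carrier G" for g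
      using averaged_intertwiner[OF rep rep unit_mat_carrier that] .
    ultimately obtain c where c: "?T = c \<cdot>\<^sub>m 1\<^sub>m n"
      using schur_scalar[OF irr] by blast
    have "mat_trace (unit_mat n n i j) = (\<Sum>k<n. if k = i then (if i = j then 1 else 0) else 0)"
      by (auto simp: mat_trace_def unit_mat_def intro!: sum.cong)
    then have trE: "mat_trace (unit_mat n n i j) = (if i = j then 1 else 0)"
      using ij by (simp add: sum.delta)
    have "c * of_nat n = mat_trace ?T"
      unfolding c by (simp add: mat_trace_smult[of _ n] mat_trace_one)
    also have "\<dots> = (\<Sum>g\<in>carrier G. mat_trace (\<rho> g * unit_mat n n i j * \<rho> (inv g)))"
      by (intro mat_trace_mat_sum mult_carrier_mat[of _ n n] rep_carrier[OF rep]) auto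
    also have "\<dots> = (\<Sum>g\<in>carrier G. mat_trace (unit_mat n n i j))"
      by (intro sum.cong refl mat_trace_conjugate[of _ n _ n] rep_carrier[OF rep] rep_inv_left[OF rep]) auto
    also have "\<dots> = (if i = j then of_nat (Coset.order G) else 0)" by (simp add: trE Coset.order_def)
    finally have "c * of_nat n = (if i = j then of_nat (Coset.order G) else 0)" .
    then show ?thesis using ij n unfolding c by (auto simp: field_simps)
  qed
  have "(\<Sum>g\<in>carrier G. mat_trace (\<rho> g) * mat_trace (\<rho> (inv g)))
      = (\<Sum>i<n. \<Sum>j<n. if i = j then of_nat (Coset.order G) / of_nat n else 0)"
    unfolding sum_rep_traces_eq_averaged[OF rep rep] by (intro sum.cong refl) (simp only: entry lessThan_iff)
  also have "\<dots> = (\<Sum>i<n. of_nat (Coset.order G) / of_nat n)"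
    by (intro sum.cong refl) simp
  also have "\<dots> = of_nat (Coset.order G)" using n by simp
  finally show ?thesis .
qed

section \<open>Class functions are determined by the irreducible characters\<close>

text \<open>In a basis adapted to an invariant subspace the representation is block upper triangular, and the two
diagonal blocks are the representations on the subspace and on the quotient. The trace only sees the
diagonal blocks.\<close>

lemma reducible_trace_split:
  assumes rep: "group_representation G n \<rho>" and n: "n > 0"
    and red: "\<not> irreducible_representation G n \<rho>"
  obtains m \<rho>1 \<rho>2 where "0 < m" "m < n"
    "group_representation G m \<rho>1" "group_representation G (n - m) \<rho>2"
    "\<And>g. g \<in> carrier G \<Longrightarrow> mat_trace (\<rho> g) = mat_trace (\<rho>1 g) + mat_trace (\<rho>2 g)"
proof -
  obtain W where W: "VectorSpace.subspace class_ring W (module_vec TYPE(complex) n)"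
      "W \<noteq> {0\<^sub>v n}" "W \<noteq> carrier_vec n"
    and inv: "\<And>g w. g \<in> carrier G \<Longrightarrow> w \<in> W \<Longrightarrow> \<rho> g *\<^sub>v w \<in> W"
    using red rep n unfolding irreducible_representation_def by blast
  obtain m P Q where m: "0 < m" "m < n"
    and P: "P \<in> carrier_mat n n" and Q: "Q \<in> carrier_mat n n"
    and QP: "Q * P = 1\<^sub>m n" and PQ: "P * Q = 1\<^sub>m n"
    and colP: "\<And>j. j < m \<Longrightarrow> col P j \<in> W"
    and supp: "\<And>w i. w \<in> W \<Longrightarrow> m \<le> i \<Longrightarrow> i < n \<Longrightarrow> (Q *\<^sub>v w) $ i = 0"
    by (rule subspace_adapted_basis[OF W]) blast
  note R = rep_carrier[OF rep]
  define \<tau> where "\<tau> g = Q * \<rho> g * P" for g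
  have \<tau>: "\<tau> g \<in> carrier_mat n n" if "g \<in> carrier G" for g
    using R[OF that] P Q by (auto simp: \<tau>_def)
  have \<tau>_mult: "\<tau> (g \<otimes> h) = \<tau> g * \<tau> h" if "g \<in> carrier G" "h \<in> carrier G" for g h
  proof -
    have "\<tau> g * \<tau> h = Q * \<rho> g * (P * (Q * (\<rho> h * P)))"
      using R[OF that(1)] R[OF that(2)] P Q
      by (simp add: \<tau>_def assoc_mult_mat[of _ n n _ n _ n] mult_carrier_mat[of _ n n _ n])
    also have "P * (Q * (\<rho> h * P)) = \<rho> h * P"
      using R[OF that(2)] P Q assoc_mult_mat[OF P Q, of "\<rho> h * P" n] by (simp add: PQ)
    finally show ?thesis
      using R[OF that(1)] R[OF that(2)] P Q that
      by (simp add: \<tau>_def rep_mult[OF rep] assoc_mult_mat[of _ n n _ n _ n] mult_carrier_mat[of _ n n _ n])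
  qed
  have \<tau>_one: "\<tau> \<one> = 1\<^sub>m n"
    using Q by (simp add: \<tau>_def rep_one[OF rep] QP)
  have \<tau>_zero: "\<tau> g $$ (i, j) = 0" if g: "g \<in> carrier G" and ij: "m \<le> i" "i < n" "j < m" for g i j
  proof -
    have "\<tau> g = Q * (\<rho> g * P)"
      using R[OF g] P Q by (simp add: \<tau>_def assoc_mult_mat[of _ n n _ n _ n])
    then have "col (\<tau> g) j = Q *\<^sub>v (\<rho> g *\<^sub>v col P j)"
      using col_mult2[OF Q mult_carrier_mat[OF R[OF g] P], of j] col_mult2[OF R[OF g] P, of j] ij m by simp
    moreover have "\<tau> g $$ (i, j) = col (\<tau> g) j $ i" using \<tau>[OF g] ij m by simp
    ultimately show ?thesis using supp[OF inv[OF g colP[OF ij(3)]] ij(1,2)] by simp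
  qed
  define A where "A g = mat m m (\<lambda>(i, j). \<tau> g $$ (i, j))" for g
  define B where "B g = mat m (n - m) (\<lambda>(i, j). \<tau> g $$ (i, j + m))" for g
  define D where "D g = mat (n - m) (n - m) (\<lambda>(i, j). \<tau> g $$ (i + m, j + m))" for g
  have blocks: "\<tau> g = four_block_mat (A g) (B g) (0\<^sub>m (n - m) m) (D g)" if "g \<in> carrier G" for g
    using \<tau>[OF that] m \<tau>_zero[OF that]
    by (intro eq_matI) (auto simp: A_def B_def D_def)
  have carr: "A g \<in> carrier_mat m m" "B g \<in> carrier_mat m (n - m)" "D g \<in> carrier_mat (n - m) (n - m)" for g
    by (auto simp: A_def B_def D_def)
  have AD_mult: "A (g \<otimes> h) = A g * A h \<and> D (g \<otimes> h) = D g * D h" if gh: "g \<in> carrier G" "h \<in> carrier G" for g h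
  proof -
    have eq: "\<tau> (g \<otimes> h) = four_block_mat (A g * A h) (A g * B h + B g * D h) (0\<^sub>m (n - m) m) (D g * D h)"
      unfolding \<tau>_mult[OF gh] blocks[OF gh(1)] blocks[OF gh(2)]
      by (subst mult_four_block_mat[OF carr(1,2) zero_carrier_mat carr(3) carr(1,2) zero_carrier_mat carr(3)])
        (use carr[of g] carr[of h] in \<open>simp add: left_mult_zero_mat[of _ _ m] right_mult_zero_mat[of _ _ "n - m"]
          right_add_zero_mat[of _ m m] left_add_zero_mat[of _ "n - m" "n - m"]
          mult_carrier_mat[of _ m m _ m] mult_carrier_mat[of _ "n - m" "n - m" _ "n - m"]\<close>)
    have "A (g \<otimes> h) = A g * A h"
      using m carr[of g] carr[of h] unfolding A_def[of "g \<otimes> h"] eq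
      by (intro eq_matI) (auto simp del: index_mult_mat(1))
    moreover have "D (g \<otimes> h) = D g * D h"
      using m carr[of g] carr[of h] unfolding D_def[of "g \<otimes> h"] eq
      by (intro eq_matI) (auto simp del: index_mult_mat(1))
    ultimately show ?thesis by simp
  qed
  have repA: "group_representation G m A"
    using m AD_mult by (intro group_representationI carr(1)) (auto simp: A_def \<tau>_one intro!: eq_matI)
  have repD: "group_representation G (n - m) D"
    using m AD_mult by (intro group_representationI carr(3)) (auto simp: D_def \<tau>_one intro!: eq_matI)
  have sum_split: "(\<Sum>i<m + d. s i) = (\<Sum>i<m. s i) + (\<Sum>i<d. s (i + m))" for s :: "nat \<Rightarrow> complex" and m d
    by (induction d) (simp_all add: add.assoc add.commute[of _ m])
  have tr: "mat_trace (\<rho> g) = mat_trace (A g) + mat_trace (D g)" if g: "g \<in> carrier G" for g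
  proof -
    have "mat_trace (\<rho> g) = mat_trace (\<tau> g)"
      unfolding \<tau>_def by (rule mat_trace_conjugate[OF R[OF g] Q P PQ, symmetric])
    also have "\<dots> = (\<Sum>i<n. \<tau> g $$ (i, i))" using \<tau>[OF g] by (simp add: mat_trace_def)
    also have "\<dots> = (\<Sum>i<m. \<tau> g $$ (i, i)) + (\<Sum>i<n - m. \<tau> g $$ (i + m, i + m))"
      using sum_split[of "\<lambda>i. \<tau> g $$ (i, i)" m "n - m"] m by simp
    also have "\<dots> = mat_trace (A g) + mat_trace (D g)"
      by (simp add: mat_trace_def A_def D_def)
    finally show ?thesis .
  qed
  show ?thesis using that m repA repD tr by blast
qed

text \<open>Splitting off invariant subspaces writes the trace of any representation as a sum of irreducible
characters.\<close>

lemma annihilates_all_characters: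
  assumes ann: "\<And>\<chi>. \<chi> \<in> Irr G \<Longrightarrow> (\<Sum>g\<in>carrier G. f g * \<chi> g) = 0"
  shows "group_representation G n \<rho> \<Longrightarrow> (\<Sum>g\<in>carrier G. f g * mat_trace (\<rho> g)) = 0"
proof (induction n arbitrary: \<rho> rule: less_induct)
  case (less n)
  note rep = less.prems
  consider "n = 0" | "irreducible_representation G n \<rho>" | "n > 0" "\<not> irreducible_representation G n \<rho>"
    by blast
  then show ?case
  proof cases
    case 1
    then have "mat_trace (\<rho> g) = 0" if "g \<in> carrier G" for g
      using rep_carrier[OF rep that] by (simp add: mat_trace_def)
    then show ?thesis by simp
  next
    case 2
    then have "(\<lambda>g\<in>carrier G. mat_trace (\<rho> g)) \<in> Irr G" by (auto simp: Irr_def)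
    from ann[OF this] show ?thesis by simp
  next
    case 3
    obtain m \<rho>1 \<rho>2 where m: "0 < m" "m < n"
      and r: "group_representation G m \<rho>1" "group_representation G (n - m) \<rho>2"
      and tr: "\<And>g. g \<in> carrier G \<Longrightarrow> mat_trace (\<rho> g) = mat_trace (\<rho>1 g) + mat_trace (\<rho>2 g)"
      using reducible_trace_split[OF rep 3] by blast
    have "(\<Sum>g\<in>carrier G. f g * mat_trace (\<rho> g))
        = (\<Sum>g\<in>carrier G. f g * mat_trace (\<rho>1 g)) + (\<Sum>g\<in>carrier G. f g * mat_trace (\<rho>2 g))"
      by (simp add: tr distrib_left sum.distrib)
    also have "\<dots> = 0" using less.IH[OF m(2) r(1)] less.IH[OF _ r(2)] m by simp
    finally show ?thesis .
  qed
qed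

lemma regular_representation:
  assumes fin: "finite (carrier G)"
  obtains \<rho> where "group_representation G (Coset.order G) \<rho>"
    "mat_trace (\<rho> \<one>) = of_nat (Coset.order G)"
    "\<And>g. g \<in> carrier G \<Longrightarrow> g \<noteq> \<one> \<Longrightarrow> mat_trace (\<rho> g) = 0"
proof -
  let ?N = "Coset.order G"
  obtain e where e: "bij_betw e {..<?N} (carrier G)"
    using ex_bij_betw_nat_finite[OF fin] by (auto simp: Coset.order_def lessThan_atLeast0)
  have eG: "e i \<in> carrier G" if "i < ?N" for i using e that by (auto simp: bij_betw_def)
  have e_inj: "e i = e j \<longleftrightarrow> i = j" if "i < ?N" "j < ?N" for i j
    using e that by (auto simp: bij_betw_def inj_on_def)
  define \<rho> where "\<rho> g = mat ?N ?N (\<lambda>(i, j). if e i = g \<otimes> e j then 1 else 0 :: complex)" for g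
  have \<rho>: "\<rho> g \<in> carrier_mat ?N ?N" for g by (simp add: \<rho>_def)
  have "group_representation G ?N \<rho>"
  proof (rule group_representationI)
    show "\<rho> \<one> = 1\<^sub>m ?N" by (intro eq_matI) (auto simp: \<rho>_def eG e_inj)
    fix g h assume g: "g \<in> carrier G" and h: "h \<in> carrier G"
    show "\<rho> (g \<otimes> h) = \<rho> g * \<rho> h"
    proof (rule eq_matI)
      fix i j assume "i < dim_row (\<rho> g * \<rho> h)" "j < dim_col (\<rho> g * \<rho> h)"
      then have ij: "i < ?N" "j < ?N" by (auto simp: \<rho>_def)
      have "h \<otimes> e j \<in> carrier G" using h eG[OF ij(2)] by simp
      then obtain l where l: "l < ?N" "e l = h \<otimes> e j"
        using e by (metis bij_betw_imp_surj_on imageE lessThan_iff)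
      have "(\<rho> g * \<rho> h) $$ (i, j) = (\<Sum>k<?N. if k = l then \<rho> g $$ (i, k) else 0)"
        unfolding mult_mat_entry[OF \<rho> \<rho> ij]
        using ij l(1) by (intro sum.cong) (auto simp: \<rho>_def e_inj simp flip: l(2))
      also have "\<dots> = \<rho> g $$ (i, l)" using l(1) by (simp add: sum.delta)
      also have "\<dots> = \<rho> (g \<otimes> h) $$ (i, j)"
        using ij l g h eG by (simp add: \<rho>_def m_assoc)
      finally show "\<rho> (g \<otimes> h) $$ (i, j) = (\<rho> g * \<rho> h) $$ (i, j)" by simp
    qed (auto simp: \<rho>_def)
  qed (rule \<rho>)
  moreover have "mat_trace (\<rho> \<one>) = of_nat ?N"
    by (simp add: mat_trace_def \<rho>_def eG)
  moreover have "mat_trace (\<rho> g) = 0" if g: "g \<in> carrier G" "g \<noteq> \<one>" for g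
  proof -
    have "e i \<noteq> g \<otimes> e i" if "i < ?N" for i
      using g eG[OF that] r_cancel_one[of "e i" g] by metis
    then show ?thesis by (simp add: mat_trace_def \<rho>_def)
  qed
  ultimately show ?thesis by (rule that)
qed

text \<open>In an irreducible representation the operator \<open>\<Sum>\<^sub>g f g * \<rho> g\<close> commutes with the group because \<open>f\<close> is a
class function, so it is a scalar; its trace vanishes by hypothesis, so the operator is zero. Tracing
it against \<open>\<rho> (inv h)\<close> shows that the translates of \<open>f\<close>, which need not be class functions, also
annihilate all irreducible characters, and therefore the regular character. The latter is supported
at \<open>\<one>\<close> and reads off the value \<open>f h\<close>.\<close>

lemma class_function_eq_zero:
  assumes fin: "finite (carrier G)"
    and class_fun: "\<And>g x. g \<in> carrier G \<Longrightarrow> x \<in> carrier G \<Longrightarrow> f (g \<otimes> x \<otimes> inv g) = f x"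
    and ann: "\<And>\<chi>. \<chi> \<in> Irr G \<Longrightarrow> (\<Sum>g\<in>carrier G. f g * \<chi> g) = 0"
    and h: "h \<in> carrier G"
  shows "f h = 0"
proof -
  have shift: "(\<Sum>g\<in>carrier G. f (g \<otimes> h) * \<chi> g) = 0" if \<chi>Irr: "\<chi> \<in> Irr G" for \<chi>
  proof -
    obtain n \<rho> where irr: "irreducible_representation G n \<rho>" and \<chi>: "\<chi> = (\<lambda>g\<in>carrier G. mat_trace (\<rho> g))"
      using \<chi>Irr by (auto simp: Irr_def)
    note rep = irreducible_imp_rep[OF irr]
    note R = rep_carrier[OF rep]
    have n: "n > 0" using irr by (simp add: irreducible_representation_def)
    define T where "T = mat_sum n n (\<lambda>g. f g \<cdot>\<^sub>m \<rho> g) (carrier G)"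
    have T: "T \<in> carrier_mat n n" by (simp add: T_def)
    have fR: "f g \<cdot>\<^sub>m \<rho> g \<in> carrier_mat n n" if "g \<in> carrier G" for g using R[OF that] by simp
    have comm: "\<rho> x * T = T * \<rho> x" if x: "x \<in> carrier G" for x
    proof -
      have "T * \<rho> x = mat_sum n n (\<lambda>g. f g \<cdot>\<^sub>m \<rho> g * \<rho> x) (carrier G)"
        unfolding T_def by (rule mat_sum_mult[OF R[OF x] fR])
      also have "\<dots> = mat_sum n n (\<lambda>g. f (x \<otimes> g \<otimes> inv x) \<cdot>\<^sub>m \<rho> (x \<otimes> g \<otimes> inv x) * \<rho> x) (carrier G)"
        by (rule mat_sum_reindex_bij_betw[OF bij_betw_conj[OF x], symmetric])
      also have "\<dots> = mat_sum n n (\<lambda>g. \<rho> x * (f g \<cdot>\<^sub>m \<rho> g)) (carrier G)"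
      proof (rule mat_sum_cong)
        fix g assume g: "g \<in> carrier G"
        have "\<rho> (x \<otimes> g \<otimes> inv x) * \<rho> x = \<rho> x * \<rho> g"
          using x g by (simp flip: rep_mult[OF rep] add: m_assoc)
        then show "f (x \<otimes> g \<otimes> inv x) \<cdot>\<^sub>m \<rho> (x \<otimes> g \<otimes> inv x) * \<rho> x = \<rho> x * (f g \<cdot>\<^sub>m \<rho> g)"
          using class_fun[OF x g] mult_smult_assoc_mat[OF R[of "x \<otimes> g \<otimes> inv x"] R[OF x], of "f g"]
            mult_smult_distrib[OF R[OF x] R[OF g], of "f g"] x g by simp
      qed
      also have "\<dots> = \<rho> x * T"
        unfolding T_def by (rule mult_mat_sum[OF R[OF x] fR, symmetric])
      finally show ?thesis by simp
    qed
    obtain c where c: "T = c \<cdot>\<^sub>m 1\<^sub>m n" using schur_scalar[OF irr T comm] by blast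
    have "c * of_nat n = mat_trace T" by (simp add: c mat_trace_smult[of _ n] mat_trace_one)
    also have "\<dots> = (\<Sum>g\<in>carrier G. f g * \<chi> g)"
      unfolding T_def by (subst mat_trace_mat_sum, rule fR, assumption, intro sum.cong refl)
        (simp add: \<chi> mat_trace_smult[OF R])
    also have "\<dots> = 0" by (rule ann[OF \<chi>Irr])
    finally have "c = 0" using n by simp
    have hi: "inv h \<in> carrier G" using h by simp
    have "0 = mat_trace (T * \<rho> (inv h))"
      using R[OF hi] by (simp add: c \<open>c = 0\<close> mat_trace_def)
    also have "\<dots> = (\<Sum>g\<in>carrier G. mat_trace (f g \<cdot>\<^sub>m \<rho> g * \<rho> (inv h)))"
      unfolding T_def by (subst mat_sum_mult[OF R[OF hi]], rule fR, assumption, rule mat_trace_mat_sum)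
        (rule mult_carrier_mat[OF fR R[OF hi]])
    also have "\<dots> = (\<Sum>g\<in>carrier G. f g * mat_trace (\<rho> (g \<otimes> inv h)))"
      using hi by (intro sum.cong refl)
        (simp add: mult_smult_assoc_mat[OF R R] rep_mult[OF rep] mat_trace_smult[OF mult_carrier_mat[OF R R]])
    also have "\<dots> = (\<Sum>g\<in>carrier G. f (g \<otimes> h) * mat_trace (\<rho> (g \<otimes> h \<otimes> inv h)))"
      by (rule sum.reindex_bij_betw[OF bij_betw_right_mult[OF h], symmetric])
    also have "\<dots> = (\<Sum>g\<in>carrier G. f (g \<otimes> h) * \<chi> g)"
      using h by (intro sum.cong refl) (simp add: \<chi> m_assoc)
    finally show ?thesis by simp
  qed
  obtain \<rho> where \<rho>: "group_representation G (Coset.order G) \<rho>"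
    "mat_trace (\<rho> \<one>) = of_nat (Coset.order G)"
    "\<And>g. g \<in> carrier G \<Longrightarrow> g \<noteq> \<one> \<Longrightarrow> mat_trace (\<rho> g) = 0"
    using regular_representation[OF fin] by blast
  have "0 = (\<Sum>g\<in>carrier G. f (g \<otimes> h) * mat_trace (\<rho> g))"
    using annihilates_all_characters[of "\<lambda>g. f (g \<otimes> h)", OF shift \<rho>(1)] by simp
  also have "\<dots> = (\<Sum>g\<in>carrier G. if g = \<one> then f h * of_nat (Coset.order G) else 0)"
    using h by (intro sum.cong) (auto simp: \<rho>(2,3))
  also have "\<dots> = f h * of_nat (Coset.order G)" using fin by (simp add: sum.delta)
  finally have "f h * of_nat (Coset.order G) = 0" by simp
  moreover have "Coset.order G > 0" using fin order_gt_0_iff_finite by simp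
  ultimately show ?thesis by simp
qed

section \<open>Irreducible characters\<close>

lemma IrrE:
  assumes "\<chi> \<in> Irr G"
  obtains n \<rho> where "irreducible_representation G n \<rho>" "n > 0"
    "\<And>g. g \<in> carrier G \<Longrightarrow> \<chi> g = mat_trace (\<rho> g)" "\<chi> \<in> extensional (carrier G)"
  using assms by (auto simp: Irr_def irreducible_representation_def)

lemma Irr_one: assumes "\<chi> \<in> Irr G" obtains n where "n > 0" "\<chi> \<one> = of_nat n"
  using assms by (metis IrrE irreducible_imp_rep mat_trace_one one_closed rep_one)

lemma Irr_conj:
  "\<chi> \<in> Irr G \<Longrightarrow> g \<in> carrier G \<Longrightarrow> x \<in> carrier G \<Longrightarrow> \<chi> (g \<otimes> x \<otimes> inv g) = \<chi> x"
  by (elim IrrE) (simp add: rep_trace_conj[OF irreducible_imp_rep])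

lemma Irr_orthogonality:
  assumes fin: "finite (carrier G)" and \<chi>: "\<chi> \<in> Irr G" and \<psi>: "\<psi> \<in> Irr G"
  shows "(\<Sum>g\<in>carrier G. cnj (\<chi> g) * \<psi> g) = (if \<chi> = \<psi> then of_nat (Coset.order G) else 0)"
proof -
  obtain n \<rho> where \<rho>: "irreducible_representation G n \<rho>" 
    "\<And>g. g \<in> carrier G \<Longrightarrow> \<chi> g = mat_trace (\<rho> g)" "\<chi> \<in> extensional (carrier G)"
    using IrrE[OF \<chi>] by metis
  obtain m \<sigma> where \<sigma>: "irreducible_representation G m \<sigma>"
    "\<And>g. g \<in> carrier G \<Longrightarrow> \<psi> g = mat_trace (\<sigma> g)" "\<psi> \<in> extensional (carrier G)"
    using IrrE[OF \<psi>] by metis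
  note inv = rep_trace_inv[OF fin irreducible_imp_rep[OF \<rho>(1)]]
  show ?thesis
  proof (cases "\<chi> = \<psi>")
    case True
    then show ?thesis
      using schur_norm[OF fin \<rho>(1)] by (simp add: \<rho>(2) inv mult.commute flip: True)
  next
    case False
    then have "\<exists>g\<in>carrier G. mat_trace (\<rho> g) \<noteq> mat_trace (\<sigma> g)"
      using \<rho>(2,3) \<sigma>(2,3) by (metis extensionalityI)
    from schur_orthogonality[OF \<rho>(1) \<sigma>(1) this] False
    show ?thesis by (simp add: \<rho>(2) \<sigma>(2) inv mult.commute)
  qed
qed

lemma Irr_norm_sum:
  assumes fin: "finite (carrier G)" and \<psi>: "\<psi> \<in> Irr G"
  shows "(\<Sum>x\<in>carrier G. (cmod (\<psi> x))\<^sup>2) = real (Coset.order G)"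
proof -
  have "complex_of_real (\<Sum>x\<in>carrier G. (cmod (\<psi> x))\<^sup>2) = (\<Sum>x\<in>carrier G. cnj (\<psi> x) * \<psi> x)"
    by (simp add: complex_norm_square mult.commute del: of_real_power)
  also have "\<dots> = complex_of_real (real (Coset.order G))"
    using Irr_orthogonality[OF fin \<psi> \<psi>] by simp
  finally show ?thesis by (simp only: of_real_eq_iff)
qed

lemma trivial_in_Irr: "(\<lambda>g\<in>carrier G. 1) \<in> Irr G"
proof -
  have "irreducible_representation G 1 (\<lambda>g. 1\<^sub>m 1)"
    unfolding irreducible_representation_def
  proof (intro conjI allI impI)
    show "group_representation G 1 (\<lambda>g. 1\<^sub>m 1)" by (intro group_representationI) auto
    fix W :: "complex vec set"
    assume W: "VectorSpace.subspace class_ring W (module_vec TYPE(complex) 1) \<and>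
       (\<forall>g\<in>carrier G. \<forall>w\<in>W. 1\<^sub>m 1 *\<^sub>v w \<in> W)"
    then have sub: "W \<subseteq> carrier_vec 1" "0\<^sub>v 1 \<in> W" and smult: "\<And>c v. v \<in> W \<Longrightarrow> c \<cdot>\<^sub>v v \<in> W"
      by (auto simp: VectorSpace.subspace_def submodule_def module_vec_simps)
    show "W = {0\<^sub>v 1} \<or> W = carrier_vec 1"
    proof (cases "W = {0\<^sub>v 1}")
      case False
      then obtain w where w: "w \<in> W" "w \<noteq> 0\<^sub>v 1" using sub by blast
      then have w0: "w $ 0 \<noteq> 0" using sub by (auto simp: vec_eq_iff)
      have "v \<in> W" if v: "v \<in> carrier_vec 1" for v
      proof -
        have "v = (v $ 0 / w $ 0) \<cdot>\<^sub>v w" using v w w0 sub by (intro eq_vecI) auto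
        then show ?thesis using smult[OF w(1)] by metis
      qed
      then show ?thesis using sub by blast
    qed simp
  qed simp
  then show ?thesis unfolding Irr_def by (force simp: mat_trace_def)
qed

text \<open>The sum of \<open>\<rho>\<close> over \<open>N\<close> is an intertwiner because \<open>N\<close> is normal, so it is a scalar; its trace is
\<open>\<chi> \<one>\<close>, so the scalar is \<open>1\<close>. Left multiplication by \<open>\<rho> x\<close> with \<open>x \<in> N\<close> only permutes the summands,
whence \<open>\<rho> x = 1\<close>. But then \<open>\<chi> x = \<chi> \<one> \<noteq> 0\<close>, which the hypothesis forbids for \<open>x \<noteq> \<one>\<close>.\<close>

lemma Irr_normal_kernel:
  assumes fin: "finite (carrier G)" and \<chi>: "\<chi> \<in> Irr G" and N: "N \<lhd> G"
    and van: "\<And>x. x \<in> N \<Longrightarrow> x \<noteq> \<one> \<Longrightarrow> \<chi> x = 0"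
  shows "N = {\<one>}"
proof -
  interpret N: normal N G by (rule N)
  obtain n \<rho> where irr: "irreducible_representation G n \<rho>" and n: "n > 0" 
    and \<chi>\<rho>: "\<And>g. g \<in> carrier G \<Longrightarrow> \<chi> g = mat_trace (\<rho> g)"
    using IrrE[OF \<chi>] by metis
  note rep = irreducible_imp_rep[OF irr]
  note R = rep_carrier[OF rep]
  have RN: "\<rho> x \<in> carrier_mat n n" if "x \<in> N" for x using R that N.subset by blast
  have finN: "finite N" using fin N.subset finite_subset by blast
  define T where "T = mat_sum n n \<rho> N"
  have T: "T \<in> carrier_mat n n" by (simp add: T_def)
  have comm: "\<rho> g * T = T * \<rho> g" if g: "g \<in> carrier G" for g
  proof -
    have cancel: "g \<otimes> (inv g \<otimes> y) = y" "inv g \<otimes> (g \<otimes> y) = y" if "y \<in> carrier G" for y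
      using g that by (simp_all flip: m_assoc)
    have bij: "bij_betw (\<lambda>x. g \<otimes> x \<otimes> inv g) N N"
    proof (rule bij_betw_byWitness[where f' = "\<lambda>x. inv g \<otimes> x \<otimes> g"])
      show "\<forall>x\<in>N. inv g \<otimes> (g \<otimes> x \<otimes> inv g) \<otimes> g = x" "\<forall>x\<in>N. g \<otimes> (inv g \<otimes> x \<otimes> g) \<otimes> inv g = x"
        using g N.subset cancel by (auto simp: m_assoc subset_iff)
    qed (use g N.inv_op_closed1 N.inv_op_closed2 in auto)
    have "T * \<rho> g = mat_sum n n (\<lambda>x. \<rho> x * \<rho> g) N"
      unfolding T_def by (rule mat_sum_mult[OF R[OF g] RN])
    also have "\<dots> = mat_sum n n (\<lambda>x. \<rho> (g \<otimes> x \<otimes> inv g) * \<rho> g) N"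
      by (rule mat_sum_reindex_bij_betw[OF bij, symmetric])
    also have "\<dots> = mat_sum n n (\<lambda>x. \<rho> g * \<rho> x) N"
      using g N.subset by (intro mat_sum_cong) (auto simp flip: rep_mult[OF rep] simp: m_assoc subset_iff)
    also have "\<dots> = \<rho> g * T"
      unfolding T_def by (rule mult_mat_sum[OF R[OF g] RN, symmetric])
    finally show ?thesis by simp
  qed
  obtain c where c: "T = c \<cdot>\<^sub>m 1\<^sub>m n" using schur_scalar[OF irr T comm] by blast
  have "c * of_nat n = mat_trace T" by (simp add: c mat_trace_smult[of _ n] mat_trace_one)
  also have "\<dots> = (\<Sum>x\<in>N. \<chi> x)"
    unfolding T_def by (subst mat_trace_mat_sum, rule RN, assumption, intro sum.cong refl)
      (use N.subset in \<open>auto simp: \<chi>\<rho>\<close>)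
  also have "\<dots> = (\<Sum>x\<in>N. if x = \<one> then \<chi> \<one> else 0)" by (intro sum.cong) (auto simp: van)
  also have "\<dots> = of_nat n"
    using finN by (simp add: sum.delta \<chi>\<rho> rep_one[OF rep] mat_trace_one)
  finally have "c = 1" using n by simp
  then have T1: "T = 1\<^sub>m n" using c by (auto intro!: eq_matI)
  have "x = \<one>" if x: "x \<in> N" for x
  proof (rule ccontr)
    assume "x \<noteq> \<one>"
    have bij: "bij_betw (\<lambda>y. x \<otimes> y) N N"
      using x N.subset by (intro bij_betw_byWitness[where f' = "\<lambda>y. inv x \<otimes> y"])
        (auto simp flip: m_assoc simp: subset_iff)
    have xG: "x \<in> carrier G" using x N.subset by blast
    have "\<rho> x * T = mat_sum n n (\<lambda>y. \<rho> x * \<rho> y) N"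
      unfolding T_def by (rule mult_mat_sum[OF R[OF xG] RN])
    also have "\<dots> = mat_sum n n (\<lambda>y. \<rho> (x \<otimes> y)) N"
      using xG N.subset by (intro mat_sum_cong) (auto simp: rep_mult[OF rep])
    also have "\<dots> = T" unfolding T_def by (rule mat_sum_reindex_bij_betw[OF bij])
    finally have "\<rho> x = 1\<^sub>m n" using R[OF xG] by (simp add: T1)
    then have "\<chi> x = of_nat n" by (simp add: \<chi>\<rho>[OF xG] mat_trace_one)
    with van[OF x \<open>x \<noteq> \<one>\<close>] n show False by simp
  qed
  then show ?thesis using N.one_closed by blast
qed

text \<open>In an abelian group each \<open>\<rho> x\<close> is itself an intertwiner, hence an invertible scalar.\<close>

lemma abelian_Irr_nonzero:
  assumes comm: "\<And>g h. g \<in> carrier G \<Longrightarrow> h \<in> carrier G \<Longrightarrow> g \<otimes> h = h \<otimes> g"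
    and \<chi>: "\<chi> \<in> Irr G" and x: "x \<in> carrier G"
  shows "\<chi> x \<noteq> 0"
proof
  assume 0: "\<chi> x = 0"
  obtain n \<rho> where irr: "irreducible_representation G n \<rho>" and n: "n > 0" 
    and \<chi>\<rho>: "\<And>g. g \<in> carrier G \<Longrightarrow> \<chi> g = mat_trace (\<rho> g)"
    using IrrE[OF \<chi>] by metis
  note rep = irreducible_imp_rep[OF irr]
  have "\<rho> g * \<rho> x = \<rho> x * \<rho> g" if "g \<in> carrier G" for g
    using that x comm[OF that x] by (simp flip: rep_mult[OF rep])
  then obtain c where c: "\<rho> x = c \<cdot>\<^sub>m 1\<^sub>m n"
    using schur_scalar[OF irr rep_carrier[OF rep x]] by blast
  then have "c = 0" using 0 n x by (simp add: \<chi>\<rho> mat_trace_smult[of _ n] mat_trace_one)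
  have "1\<^sub>m n = \<rho> x * \<rho> (inv x)" using rep_inv_right[OF rep x] by simp
  also have "\<dots> = 0\<^sub>m n n"
    unfolding c \<open>c = 0\<close> using rep_carrier[OF rep, of "inv x"] x by (intro eq_matI) auto
  finally have "mat_trace (1\<^sub>m n) = mat_trace (0\<^sub>m n n)" by simp
  then show False using n by (simp add: mat_trace_one) (simp add: mat_trace_def)
qed

section \<open>Conjugacy classes\<close>

lemma conj_action_is_group_action: "group_action G (carrier G) (conj_action G)"
  using action_by_conjugation by (simp add: conj_action_def)

lemma conj_class_eq:
  "x \<in> carrier G \<Longrightarrow> conj_class G x = {g \<otimes> x \<otimes> inv g |g. g \<in> carrier G}"
  by (auto simp: conj_class_def orbit_def conj_action_def)

lemma conj_class_subset: "x \<in> carrier G \<Longrightarrow> conj_class G x \<subseteq> carrier G"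
  by (auto simp: conj_class_eq)

lemma conj_class_refl: "x \<in> carrier G \<Longrightarrow> x \<in> conj_class G x"
  unfolding conj_class_def by (rule group_action.orbit_refl[OF conj_action_is_group_action])

lemma conj_class_one: "conj_class G \<one> = {\<one>}"
  using conj_class_refl[of \<one>] by (auto simp: conj_class_eq)

lemma conj_class_in_classes: "x \<in> carrier G \<Longrightarrow> conj_class G x \<in> conj_classes G"
  by (auto simp: conj_class_def conj_classes_def orbits_def)

lemma conj_classes_cases:
  assumes "C \<in> conj_classes G"
  obtains x where "x \<in> carrier G" "C = conj_class G x"
  using assms by (auto simp: conj_class_def conj_classes_def orbits_def)

lemma conj_class_eqI:
  assumes "x \<in> carrier G" "y \<in> conj_class G x"
  shows "conj_class G y = conj_class G x"
proof -
  have y: "y \<in> carrier G" using assms conj_class_subset by blast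
  have "conj_class G x \<inter> conj_class G y \<noteq> {}" using assms conj_class_refl[OF y] by blast
  then show ?thesis
    using group_action.disjoint_union[OF conj_action_is_group_action]
      conj_class_in_classes[OF assms(1)] conj_class_in_classes[OF y]
    unfolding conj_classes_def by metis
qed

lemma one_in_conj_class: "x \<in> carrier G \<Longrightarrow> \<one> \<in> conj_class G x \<Longrightarrow> x = \<one>"
  using conj_class_eqI[of x \<one>] conj_class_refl[of x] conj_class_one by blast

lemma Irr_conj_class:
  "\<chi> \<in> Irr G \<Longrightarrow> x \<in> carrier G \<Longrightarrow> y \<in> conj_class G x \<Longrightarrow> \<chi> y = \<chi> x"
  by (auto simp: conj_class_eq Irr_conj)

text \<open>A class size divides the group order, and here it would be the group order minus one.\<close>

lemma order_le_2_if_two_classes: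
  assumes fin: "finite (carrier G)" and b: "b \<in> carrier G" and G: "carrier G = insert \<one> (conj_class G b)"
  shows "Coset.order G \<le> 2"
proof (cases "b = \<one>")
  case True
  then show ?thesis using G by (simp add: Coset.order_def conj_class_one)
next
  case False
  let ?k = "card (conj_class G b)"
  have "finite (conj_class G b)" using fin conj_class_subset[OF b] finite_subset by blast
  then have "Coset.order G = Suc ?k"
    using False one_in_conj_class[OF b] by (subst Coset.order_def, subst G) (auto simp: card_insert_if)
  moreover have "?k dvd Coset.order G"
    using group_action.orbit_stabilizer_theorem[OF conj_action_is_group_action b]
    unfolding conj_class_def by (metis dvd_triv_left)
  ultimately have "?k dvd 1" using dvd_add_right_iff[of ?k ?k 1] by simp
  then show ?thesis using \<open>Coset.order G = Suc ?k\<close> by simp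
qed

section \<open>Characters supported on the identity and one further class\<close>

text \<open>The condition constrains the zeros only: when \<open>|G| > 2\<close>, the values at \<open>\<one>\<close> and \<open>b\<close> are nonzero by
\<open>two_class_nonzero\<close>.\<close>

definition two_class_character :: "('a \<Rightarrow> complex) \<Rightarrow> 'a \<Rightarrow> bool" where
  "two_class_character \<chi> b \<longleftrightarrow> \<chi> \<in> Irr G \<and> b \<in> carrier G \<and> b \<noteq> \<one> \<and>
     (\<forall>x\<in>carrier G. x \<noteq> \<one> \<and> x \<notin> conj_class G b \<longrightarrow> \<chi> x = 0)"

text \<open>The class function \<open>f\<close> below is the difference of the averages over the two classes minus a multiple
of \<open>cnj \<chi>\<close>; the factor \<open>d\<close> is chosen to make \<open>f\<close> orthogonal to \<open>\<chi>\<close> as well, so that \<open>f = 0\<close>. Off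
the two classes only the multiple of \<open>cnj \<chi>\<close> is left.\<close>

lemma columns_differ_once_vanish:
  assumes fin: "finite (carrier G)" and a: "a \<in> carrier G" and b: "b \<in> carrier G"
    and \<chi>: "\<chi> \<in> Irr G" "\<chi> a \<noteq> \<chi> b" and eq: "\<And>\<psi>. \<psi> \<in> Irr G \<Longrightarrow> \<psi> \<noteq> \<chi> \<Longrightarrow> \<psi> a = \<psi> b"
    and x: "x \<in> carrier G" "x \<notin> conj_class G a" "x \<notin> conj_class G b"
  shows "\<chi> x = 0"
proof -
  let ?A = "conj_class G a" and ?B = "conj_class G b"
  have fA: "finite ?A" and fB: "finite ?B"
    using fin conj_class_subset a b finite_subset by blast+
  have "Coset.order G > 0" using fin order_gt_0_iff_finite by simp
  define d where "d = (\<chi> a - \<chi> b) / of_nat (Coset.order G)"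
  have d: "d \<noteq> 0" using \<chi> \<open>Coset.order G > 0\<close> by (simp add: d_def)
  define avg where "avg C g = (if g \<in> C then 1 / of_nat (card C) else (0::complex))" for C and g :: 'a
  define f where "f g = avg ?A g - avg ?B g - d * cnj (\<chi> g)" for g
  have avg_class: "avg (conj_class G y) (g \<otimes> z \<otimes> inv g) = avg (conj_class G y) z"
    if "g \<in> carrier G" "z \<in> carrier G" "y \<in> carrier G" for g y z
  proof -
    have gz: "g \<otimes> z \<otimes> inv g \<in> conj_class G z" using that by (auto simp: conj_class_eq)
    have "g \<otimes> z \<otimes> inv g \<in> conj_class G y \<longleftrightarrow> z \<in> conj_class G y"
      using conj_class_eqI[OF that(3)] conj_class_eqI[OF that(2) gz] gz conj_class_refl[OF that(2)] by metis
    then show ?thesis by (simp add: avg_def)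
  qed
  have avg_sum: "(\<Sum>g\<in>carrier G. avg (conj_class G y) g * \<psi> g) = \<psi> y"
    if y: "y \<in> carrier G" and \<psi>: "\<psi> \<in> Irr G" for y \<psi>
  proof -
    have fin_y: "finite (conj_class G y)" using fin conj_class_subset[OF y] finite_subset by blast
    have "(\<Sum>g\<in>carrier G. avg (conj_class G y) g * \<psi> g)
        = (\<Sum>g\<in>conj_class G y. avg (conj_class G y) g * \<psi> g)"
      using fin conj_class_subset[OF y] by (intro sum.mono_neutral_right) (auto simp: avg_def)
    also have "\<dots> = (\<Sum>g\<in>conj_class G y. 1 / of_nat (card (conj_class G y)) * \<psi> y)"
      using Irr_conj_class[OF \<psi> y] by (intro sum.cong) (auto simp: avg_def)
    also have "\<dots> = \<psi> y" using fin_y conj_class_refl[OF y] by (auto simp: card_gt_0_iff)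
    finally show ?thesis .
  qed
  have "f x = 0"
  proof (rule class_function_eq_zero[OF fin _ _ x(1)])
    show "f (g \<otimes> z \<otimes> inv g) = f z" if "g \<in> carrier G" "z \<in> carrier G" for g z
      using that a b by (simp add: f_def avg_class Irr_conj[OF \<chi>(1)])
    show "(\<Sum>g\<in>carrier G. f g * \<psi> g) = 0" if \<psi>: "\<psi> \<in> Irr G" for \<psi>
    proof -
      have "(\<Sum>g\<in>carrier G. f g * \<psi> g) = (\<Sum>g\<in>carrier G. avg ?A g * \<psi> g)
          - (\<Sum>g\<in>carrier G. avg ?B g * \<psi> g) - d * (\<Sum>g\<in>carrier G. cnj (\<chi> g) * \<psi> g)"
        by (simp add: f_def left_diff_distrib sum_subtractf sum_distrib_left mult.assoc)
      also have "\<dots> = \<psi> a - \<psi> b - d * (if \<chi> = \<psi> then of_nat (Coset.order G) else 0)"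
        by (simp only: avg_sum[OF a \<psi>] avg_sum[OF b \<psi>] Irr_orthogonality[OF fin \<chi>(1) \<psi>])
      also have "\<dots> = 0"
        using eq[OF \<psi>] \<open>Coset.order G > 0\<close> by (auto simp: d_def)
      finally show ?thesis .
    qed
  qed
  then show ?thesis using x d by (simp add: f_def avg_def)
qed

lemma columns_differ_once_imp_two_class:
  assumes fin: "finite (carrier G)" and a: "a \<in> carrier G" and b: "b \<in> carrier G"
    and cdo: "columns_differ_once G a b"
  shows "(a = \<one> \<and> (\<exists>\<chi>. two_class_character \<chi> b)) \<or> (b = \<one> \<and> (\<exists>\<chi>. two_class_character \<chi> a))"
proof -
  obtain \<chi> where \<chi>: "\<chi> \<in> Irr G" "\<chi> a \<noteq> \<chi> b" and eq: "\<And>\<psi>. \<psi> \<in> Irr G \<Longrightarrow> \<psi> \<noteq> \<chi> \<Longrightarrow> \<psi> a = \<psi> b"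
    using cdo unfolding columns_differ_once_def by blast
  note van = columns_differ_once_vanish[OF fin a b \<chi> eq]
  have "\<chi> \<one> \<noteq> 0" using Irr_one[OF \<chi>(1)] by (metis less_numeral_extra(3) of_nat_eq_0_iff)
  then have "\<one> \<in> conj_class G a \<or> \<one> \<in> conj_class G b" using van[of \<one>] by auto
  then have "a = \<one> \<or> b = \<one>" using one_in_conj_class a b by blast
  moreover have "a \<noteq> b" using \<chi>(2) by auto
  ultimately show ?thesis
    using van \<chi>(1) a b unfolding two_class_character_def by (auto simp: conj_class_one)
qed

context
  fixes \<chi> b
  assumes fin: "finite (carrier G)" and gt2: "Coset.order G > 2"
    and tcc: "two_class_character \<chi> b"
begin

lemma two_class_D: "\<chi> \<in> Irr G" "b \<in> carrier G" "b \<noteq> \<one>"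
    "\<And>x. x \<in> carrier G \<Longrightarrow> x \<noteq> \<one> \<Longrightarrow> x \<notin> conj_class G b \<Longrightarrow> \<chi> x = 0"
  using tcc unfolding two_class_character_def by blast+

lemma two_class_vanishes_somewhere: obtains x where "x \<in> carrier G" "\<chi> x = 0"
proof -
  have "carrier G \<noteq> insert \<one> (conj_class G b)"
    using order_le_2_if_two_classes[OF fin two_class_D(2)] gt2 by fastforce
  then show ?thesis
    using that two_class_D(4) conj_class_subset[OF two_class_D(2)] by blast
qed

lemma two_class_finite: "finite (conj_class G b)"
  using fin conj_class_subset[OF two_class_D(2)] finite_subset by blast

lemma two_class_card_pos: "card (conj_class G b) > 0"
  using two_class_finite conj_class_refl[OF two_class_D(2)] by (auto simp: card_gt_0_iff)

lemma two_class_sum: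
  assumes f: "\<And>x. x \<in> conj_class G b \<Longrightarrow> f x = f b"
    "\<And>x. x \<in> carrier G \<Longrightarrow> x \<noteq> \<one> \<Longrightarrow> x \<notin> conj_class G b \<Longrightarrow> f x = (0 :: 'c :: {comm_semiring_1})"
  shows "(\<Sum>x\<in>carrier G. f x) = f \<one> + of_nat (card (conj_class G b)) * f b"
proof -
  have "(\<Sum>x\<in>carrier G. f x) = (\<Sum>x\<in>insert \<one> (conj_class G b). f x)"
    using fin f(2) conj_class_subset[OF two_class_D(2)] by (intro sum.mono_neutral_right) auto
  also have "\<dots> = f \<one> + (\<Sum>x\<in>conj_class G b. f x)"
    using two_class_finite one_in_conj_class[OF two_class_D(2)] two_class_D(3) by (subst sum.insert) auto
  also have "(\<Sum>x\<in>conj_class G b. f x) = of_nat (card (conj_class G b)) * f b"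
    using f(1) by simp
  finally show ?thesis .
qed

text \<open>This is orthogonality to the trivial character, from which \<open>\<chi>\<close> differs because it has a zero.\<close>

lemma two_class_values: "\<chi> \<one> = - of_nat (card (conj_class G b)) * \<chi> b"
proof -
  let ?one = "\<lambda>g\<in>carrier G. 1 :: complex"
  obtain z where z: "z \<in> carrier G" "\<chi> z = 0" by (rule two_class_vanishes_somewhere)
  then have "?one \<noteq> \<chi>" by (metis restrict_apply' zero_neq_one)
  then have "0 = (\<Sum>x\<in>carrier G. cnj (?one x) * \<chi> x)"
    using Irr_orthogonality[OF fin trivial_in_Irr two_class_D(1)] by simp
  also have "\<dots> = (\<Sum>x\<in>carrier G. \<chi> x)" by simp
  also have "\<dots> = \<chi> \<one> + of_nat (card (conj_class G b)) * \<chi> b"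
    by (rule two_class_sum) (use two_class_D Irr_conj_class in blast)+
  finally show ?thesis by (simp add: eq_neg_iff_add_eq_0)
qed

lemma two_class_nonzero: "\<chi> \<one> \<noteq> 0" "\<chi> b \<noteq> 0"
  using Irr_one[OF two_class_D(1)] two_class_values by (metis less_numeral_extra(3) mult_zero_right of_nat_eq_0_iff)+

text \<open>By \<open>two_class_values\<close> the two terms of the pairing with \<open>\<psi>\<close> have opposite coefficients.\<close>

lemma two_class_other_constant:
  assumes \<psi>: "\<psi> \<in> Irr G" "\<psi> \<noteq> \<chi>"
  shows "\<psi> b = \<psi> \<one>"
proof -
  let ?m = "of_nat (card (conj_class G b)) :: complex"
  have "0 = (\<Sum>x\<in>carrier G. cnj (\<chi> x) * \<psi> x)"
    using Irr_orthogonality[OF fin two_class_D(1) \<psi>(1)] \<psi>(2) by simp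
  also have "\<dots> = cnj (\<chi> \<one>) * \<psi> \<one> + ?m * (cnj (\<chi> b) * \<psi> b)"
    using Irr_conj_class[OF two_class_D(1,2)] Irr_conj_class[OF \<psi>(1) two_class_D(2)] two_class_D(4)
    by (intro two_class_sum[of "\<lambda>x. cnj (\<chi> x) * \<psi> x"]) simp_all
  also have "\<dots> = cnj (\<chi> \<one>) * (\<psi> \<one> - \<psi> b)"
    by (simp add: two_class_values algebra_simps)
  finally show ?thesis using two_class_nonzero(1) by simp
qed

lemma two_class_columns_differ: "columns_differ_once G \<one> b"
proof -
  let ?m = "card (conj_class G b)"
  have "\<chi> \<one> \<noteq> \<chi> b"
  proof
    assume "\<chi> \<one> = \<chi> b"
    then have "\<chi> b + of_nat ?m * \<chi> b = 0"
      using two_class_values by (metis add.commute add.right_inverse mult_minus_left)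
    then have "of_nat (Suc ?m) * \<chi> b = 0" by (simp add: distrib_right)
    then show False using two_class_nonzero(2) by (simp only: mult_eq_0_iff of_nat_eq_0_iff) simp
  qed
  then show ?thesis
    unfolding columns_differ_once_def using two_class_D(1) two_class_other_constant by metis
qed

text \<open>Write \<open>p\<close> and \<open>q\<close> for the degrees of \<open>\<psi>\<close> and \<open>\<chi>\<close>, and \<open>m\<close> for the size of the class of \<open>b\<close>. Since
\<open>\<psi>\<close> equals \<open>p\<close> on \<open>1 + m\<close> elements while \<open>|\<chi>|\<close> equals \<open>q / m\<close> on the class of \<open>b\<close>, the norm equation
yields \<open>p\<^sup>2 * (1 + m) < q\<^sup>2 + q\<^sup>2 / m\<close>. For \<open>m = 1\<close> it is the strictness that gives the result; it holds
because \<open>\<psi>\<close> does not vanish off these \<open>1 + m\<close> elements.\<close>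

lemma two_class_degree_maximal:
  assumes \<psi>: "\<psi> \<in> Irr G" "\<psi> \<noteq> \<chi>"
  shows "Re (\<psi> \<one>) < Re (\<chi> \<one>)"
proof -
  let ?B = "conj_class G b"
  let ?m = "real (card ?B)"
  obtain p where p: "p > 0" "\<psi> \<one> = of_nat p" using Irr_one[OF \<psi>(1)] by blast
  obtain q where q: "q > 0" "\<chi> \<one> = of_nat q" using Irr_one[OF two_class_D(1)] by blast
  have cq: "cmod (\<chi> \<one>) = real q" unfolding q(2) by (rule norm_of_nat)
  have \<psi>b: "\<psi> x = of_nat p" if "x \<in> insert \<one> ?B" for x
    using that two_class_other_constant[OF \<psi>] Irr_conj_class[OF \<psi>(1) two_class_D(2)] p by auto
  have BG: "insert \<one> ?B \<subseteq> carrier G" using conj_class_subset[OF two_class_D(2)] by auto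
  have m: "?m \<ge> 1" using two_class_card_pos by simp
  \<comment> \<open>Otherwise \<open>\<psi>\<close> is a two-class character too, so its values at \<open>\<one>\<close> and \<open>b\<close> have opposite signs;
      but they are equal and nonzero.\<close>
  obtain y where y: "y \<in> carrier G" "y \<notin> insert \<one> ?B" "\<psi> y \<noteq> 0"
  proof (rule ccontr)
    assume "\<not> thesis"
    then have "two_class_character \<psi> b"
      using that \<psi>(1) two_class_D unfolding two_class_character_def by blast
    then have "\<psi> \<one> = - of_nat (card ?B) * \<psi> b"
      by (rule group.two_class_values[OF is_group fin gt2])
    moreover have "\<psi> b = \<psi> \<one>" by (rule two_class_other_constant[OF \<psi>])
    ultimately have "of_nat p + of_nat (card ?B) * of_nat p = (0 :: complex)"
      using p(2) by (metis add.commute add.right_inverse mult_minus_left)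
    then have "of_nat (p + card ?B * p) = (0 :: complex)" by simp
    then show False using p(1) by (simp only: of_nat_eq_0_iff)
  qed
  have "(real p)\<^sup>2 * (1 + ?m) = (\<Sum>x\<in>insert \<one> ?B. (cmod (\<psi> x))\<^sup>2)"
    using two_class_finite one_in_conj_class[OF two_class_D(2)] two_class_D(3) \<psi>b
    by (subst sum.insert) (auto simp: algebra_simps)
  also have "\<dots> < (\<Sum>x\<in>carrier G. (cmod (\<psi> x))\<^sup>2)"
    using y by (intro sum_strict_mono2[OF fin BG, of y]) auto
  also have "\<dots> = (\<Sum>x\<in>carrier G. (cmod (\<chi> x))\<^sup>2)"
    by (simp add: Irr_norm_sum[OF fin \<psi>(1)] Irr_norm_sum[OF fin two_class_D(1)])
  also have "\<dots> = (cmod (\<chi> \<one>))\<^sup>2 + ?m * (cmod (\<chi> b))\<^sup>2"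
    by (rule two_class_sum[of "\<lambda>x. (cmod (\<chi> x))\<^sup>2"])
      (simp_all add: Irr_conj_class[OF two_class_D(1,2), of x for x] two_class_D(4))
  finally have lt: "(real p)\<^sup>2 * (1 + ?m) < (real q)\<^sup>2 + ?m * (cmod (\<chi> b))\<^sup>2" unfolding cq .
  have qm: "real q = ?m * cmod (\<chi> b)"
    unfolding cq[symmetric] two_class_values norm_mult norm_minus_cancel norm_of_nat ..
  have "?m * (cmod (\<chi> b))\<^sup>2 \<le> ?m * (?m * (cmod (\<chi> b))\<^sup>2)"
    using m mult_right_mono[OF m zero_le_power2[of "cmod (\<chi> b)"]] by (intro mult_left_mono) simp_all
  also have "\<dots> = (real q)\<^sup>2" by (simp add: qm power2_eq_square)
  finally have "(real p)\<^sup>2 * (1 + ?m) < 2 * (real q)\<^sup>2" using lt by linarith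
  moreover have "(real p)\<^sup>2 * 2 \<le> (real p)\<^sup>2 * (1 + ?m)" using m by (intro mult_left_mono) auto
  ultimately have "(real p)\<^sup>2 < (real q)\<^sup>2" by linarith
  then have "real p < real q" by (rule power2_less_imp_less) simp
  then show ?thesis using p q by simp
qed

lemma two_class_derived: "b \<in> derived G (carrier G)"
proof (rule ccontr)
  let ?D = "derived G (carrier G)"
  assume nb: "b \<notin> ?D"
  have norm: "?D \<lhd> G" by (rule derived_self_is_normal)
  interpret D: normal ?D G by (rule norm)
  have "x \<notin> conj_class G b" if x: "x \<in> ?D" for x
  proof
    assume xb: "x \<in> conj_class G b"
    have xG: "x \<in> carrier G" using x D.subset by blast
    have "b \<in> conj_class G x"
      using conj_class_eqI[OF two_class_D(2) xb] conj_class_refl[OF two_class_D(2)] by simp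
    then show False using nb D.inv_op_closed2[OF _ x] by (auto simp: conj_class_eq[OF xG])
  qed
  then have "\<chi> x = 0" if "x \<in> ?D" "x \<noteq> \<one>" for x
    using that two_class_D(4) D.subset by blast
  then have triv: "?D = {\<one>}" by (rule Irr_normal_kernel[OF fin two_class_D(1) norm])
  have comm: "g \<otimes> h = h \<otimes> g" if "g \<in> carrier G" "h \<in> carrier G" for g h
  proof -
    have "g \<otimes> h \<otimes> inv g \<otimes> inv h \<in> ?D"
      unfolding derived_def by (rule generate.incl) (use that in blast)
    then have "g \<otimes> h \<otimes> inv g \<otimes> inv h = \<one>" using triv by blast
    then have "g \<otimes> h \<otimes> inv (h \<otimes> g) = \<one>" using that by (simp add: inv_mult_group m_assoc)
    then show ?thesis using that by (metis inv_equality inv_inv m_closed inv_closed)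
  qed
  obtain z where "z \<in> carrier G" "\<chi> z = 0" by (rule two_class_vanishes_somewhere)
  then show False using abelian_Irr_nonzero[OF comm two_class_D(1)] by blast
qed

lemma two_class_derived_subset: "insert \<one> (conj_class G b) \<subseteq> derived G (carrier G)"
proof -
  interpret D: normal "derived G (carrier G)" G by (rule derived_self_is_normal)
  show ?thesis
    using two_class_derived D.inv_op_closed2 by (auto simp: conj_class_eq[OF two_class_D(2)])
qed

lemma two_class_last_row:
  assumes enum: "irr_enumeration G k \<xi>" and x: "x \<in> carrier G"
  shows "\<xi> k x = (if x = \<one> then \<xi> k \<one> else if x \<in> conj_class G b then \<xi> k b else 0)"
proof -
  have bij: "bij_betw \<xi> {1..k} (Irr G)" using enum by (simp add: irr_enumeration_def)
  then obtain j where j: "j \<in> {1..k}" "\<xi> j = \<chi>" using two_class_D(1) by (metis bij_betw_imp_surj_on imageE)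
  then have k: "k \<in> {1..k}" "j \<le> k" by auto
  then have "Re (\<xi> j \<one>) \<le> Re (\<xi> k \<one>)" using enum j by (auto simp: irr_enumeration_def)
  moreover have "\<xi> k \<in> Irr G" using bij k by (auto simp: bij_betw_def)
  ultimately have "\<xi> k = \<chi>" using two_class_degree_maximal j(2) by fastforce
  then show ?thesis
    using x two_class_D(4)[OF x] Irr_conj_class[OF two_class_D(1,2), of x] by simp
qed

text \<open>Both characters have strictly maximal degree, so they coincide, and the common character is nonzero
at \<open>b'\<close>.\<close>

lemma two_class_character_unique:
  assumes "two_class_character \<chi>' b'"
  shows "conj_class G b' = conj_class G b"
proof -
  note D' = group.two_class_D[OF is_group fin gt2 assms]
  have "\<chi>' = \<chi>"
    using two_class_degree_maximal[OF D'(1)]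
      group.two_class_degree_maximal[OF is_group fin gt2 assms two_class_D(1)] by fastforce
  then have "\<chi> b' \<noteq> 0"
    using group.two_class_nonzero(2)[OF is_group fin gt2 assms] by simp
  then have "b' \<in> conj_class G b" using two_class_D(4)[OF D'(2,3)] by blast
  then show ?thesis using conj_class_eqI two_class_D(2) by blast
qed

end

lemma special_class_iff_two_class:
  assumes fin: "finite (carrier G)" and gt2: "Coset.order G > 2"
  shows "special_class G C \<and> C \<noteq> {\<one>} \<longleftrightarrow> (\<exists>\<chi> b. two_class_character \<chi> b \<and> C = conj_class G b)"
proof
  assume "special_class G C \<and> C \<noteq> {\<one>}"
  then obtain a b where ab: "a \<in> carrier G" "b \<in> carrier G" "columns_differ_once G a b"
    and C: "C = conj_class G a \<or> C = conj_class G b" "C \<noteq> {\<one>}"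
    unfolding special_class_def by blast
  from columns_differ_once_imp_two_class[OF fin ab] C
  show "\<exists>\<chi> b. two_class_character \<chi> b \<and> C = conj_class G b"
    by (auto simp: conj_class_one)
next
  assume "\<exists>\<chi> b. two_class_character \<chi> b \<and> C = conj_class G b"
  then obtain \<chi> b where tcc: "two_class_character \<chi> b" and C: "C = conj_class G b" by blast
  note D = two_class_D[OF fin gt2 tcc]
  have "special_class G C"
    unfolding special_class_def using two_class_columns_differ[OF fin gt2 tcc] D(2) C by blast
  moreover have "C \<noteq> {\<one>}" using conj_class_refl[OF D(2)] D(3) C by auto
  ultimately show "special_class G C \<and> C \<noteq> {\<one>}" by blast
qed

lemma CD1_group_iff_two_class:
  assumes fin: "finite (carrier G)" and gt2: "Coset.order G > 2"
  shows "CD1_group G \<longleftrightarrow> (\<exists>\<chi> b. two_class_character \<chi> b)"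
proof
  assume "CD1_group G"
  then show "\<exists>\<chi> b. two_class_character \<chi> b"
    using columns_differ_once_imp_two_class[OF fin] unfolding CD1_group_def by blast
next
  assume "\<exists>\<chi> b. two_class_character \<chi> b"
  then obtain \<chi> b where tcc: "two_class_character \<chi> b" by blast
  show "CD1_group G"
    unfolding CD1_group_def
    using is_group fin gt2 two_class_columns_differ[OF fin gt2 tcc] two_class_D(2)[OF fin gt2 tcc] by blast
qed

lemma nonvanishing_classes_iff_two_class:
  assumes fin: "finite (carrier G)" and gt2: "Coset.order G > 2" and \<chi>: "\<chi> \<in> Irr G"
  shows "card {C \<in> conj_classes G. \<exists>x\<in>C. \<chi> x \<noteq> 0} = 2 \<longleftrightarrow> (\<exists>b. two_class_character \<chi> b)"
    (is "card ?S = 2 \<longleftrightarrow> _")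
proof
  have S_iff: "conj_class G x \<in> ?S \<longleftrightarrow> \<chi> x \<noteq> 0" if "x \<in> carrier G" for x
  proof -
    have "(\<exists>y\<in>conj_class G x. \<chi> y \<noteq> 0) \<longleftrightarrow> \<chi> x \<noteq> 0"
      using conj_class_refl[OF that] Irr_conj_class[OF \<chi> that] by metis
    then show ?thesis using conj_class_in_classes[OF that] by simp
  qed
  have "\<chi> \<one> \<noteq> 0" using Irr_one[OF \<chi>] by (metis less_numeral_extra(3) of_nat_eq_0_iff)
  then have one: "{\<one>} \<in> ?S" using S_iff[of \<one>] by (simp add: conj_class_one)
  {
    assume "card ?S = 2"
    then obtain U V where UV: "?S = {U, V}" "U \<noteq> V" unfolding card_2_iff by (elim exE conjE)
    have "U = {\<one>} \<or> V = {\<one>}" using one unfolding UV(1) by (simp add: eq_commute)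
    then obtain B where B: "?S = {{\<one>}, B}" "B \<noteq> {\<one>}"
    proof
      assume "U = {\<one>}"
      then show thesis using that[of V] UV by simp
    next
      assume "V = {\<one>}"
      then show thesis using that[of U] UV by (simp add: insert_commute)
    qed
    then have "B \<in> conj_classes G" by blast
    then obtain b where b: "b \<in> carrier G" "B = conj_class G b" by (rule conj_classes_cases)
    have "\<chi> x = 0" if x: "x \<in> carrier G" "x \<noteq> \<one>" "x \<notin> conj_class G b" for x
    proof (rule ccontr)
      assume "\<chi> x \<noteq> 0"
      then have "conj_class G x \<in> {{\<one>}, B}" using S_iff[OF x(1)] B(1) by simp
      then show False using conj_class_refl[OF x(1)] x b by auto
    qed
    moreover have "b \<noteq> \<one>" using B(2) b by (auto simp: conj_class_one)
    ultimately have "two_class_character \<chi> b" using \<chi> b by (simp add: two_class_character_def)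
    then show "\<exists>b. two_class_character \<chi> b" ..
  next
    assume "\<exists>b. two_class_character \<chi> b"
    then obtain b where tcc: "two_class_character \<chi> b" ..
    note D = two_class_D[OF fin gt2 tcc]
    have "?S = {{\<one>}, conj_class G b}"
    proof (intro equalityI subsetI)
      fix C assume C: "C \<in> ?S"
      then obtain x where x: "x \<in> carrier G" "C = conj_class G x" by (auto elim: conj_classes_cases)
      then have "\<chi> x \<noteq> 0" using S_iff C by blast
      then have "x = \<one> \<or> x \<in> conj_class G b" using D(4)[OF x(1)] by blast
      then show "C \<in> {{\<one>}, conj_class G b}" using conj_class_eqI[OF D(2)] x by (auto simp: conj_class_one)
    next
      fix C assume "C \<in> {{\<one>}, conj_class G b}"
      then show "C \<in> ?S" using one S_iff[OF D(2)] two_class_nonzero(2)[OF fin gt2 tcc] by auto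
    qed
    moreover have "{\<one>} \<noteq> conj_class G b" using conj_class_refl[OF D(2)] D(3) by auto
    ultimately show "card ?S = 2" by simp
  }
qed

end

theorem lemma2p2:
  fixes G :: "('a, 'b) monoid_scheme"
  assumes "group G" and "finite (carrier G)"
  shows
    "(CD1_group G \<longrightarrow>
        (\<forall>b\<in>carrier G. b \<noteq> \<one>\<^bsub>G\<^esub> \<and> special_class G (conj_class G b) \<longrightarrow>
           {\<one>\<^bsub>G\<^esub>} \<union> conj_class G b \<subseteq> derived G (carrier G) \<and>
           card (derived G (carrier G)) \<ge> 1 + card (conj_class G b) \<and>
           (\<forall>k \<chi>. irr_enumeration G k \<chi> \<longrightarrow>
              (\<forall>x\<in>carrier G. \<chi> k x =
                 (if x = \<one>\<^bsub>G\<^esub> then \<chi> k \<one>\<^bsub>G\<^esub>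
                  else if x \<in> conj_class G b then \<chi> k b else 0)))) \<and>
        (\<exists>!C. special_class G C \<and> C \<noteq> {\<one>\<^bsub>G\<^esub>})) \<and>
     (Coset.order G > 2 \<longrightarrow>
        (CD1_group G \<longleftrightarrow>
           (\<exists>\<chi>\<in>Irr G. card {C \<in> conj_classes G. \<exists>x\<in>C. \<chi> x \<noteq> 0} = 2)))"
proof -
  interpret group G by (rule assms(1))
  note fin = assms(2)
  have part_a: "{\<one>\<^bsub>G\<^esub>} \<union> conj_class G b \<subseteq> derived G (carrier G) \<and>
      card (derived G (carrier G)) \<ge> 1 + card (conj_class G b) \<and>
      (\<forall>k \<chi>. irr_enumeration G k \<chi> \<longrightarrow>
        (\<forall>x\<in>carrier G. \<chi> k x =
           (if x = \<one>\<^bsub>G\<^esub> then \<chi> k \<one>\<^bsub>G\<^esub> else if x \<in> conj_class G b then \<chi> k b else 0)))"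
    if cd1: "CD1_group G" and b: "b \<in> carrier G" "b \<noteq> \<one>\<^bsub>G\<^esub>" "special_class G (conj_class G b)" for b
  proof -
    have gt2: "Coset.order G > 2" using cd1 by (simp add: CD1_group_def)
    have "special_class G (conj_class G b) \<and> conj_class G b \<noteq> {\<one>\<^bsub>G\<^esub>}"
      using conj_class_refl[OF b(1)] b(2,3) by auto
    then obtain \<xi> c where c: "two_class_character \<xi> c" "conj_class G b = conj_class G c"
      unfolding special_class_iff_two_class[OF fin gt2] by (elim exE conjE)
    \<comment> \<open>The character comes with its own representative \<open>c\<close> of the class.\<close>
    have \<xi>: "two_class_character \<xi> b"
      using c b(1,2) by (simp add: two_class_character_def)
    note sub = two_class_derived_subset[OF fin gt2 \<xi>]
    have "1 + card (conj_class G b) = card (insert \<one>\<^bsub>G\<^esub> (conj_class G b))"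
      using two_class_finite[OF fin gt2 \<xi>] one_in_conj_class[OF b(1)] b(2) by (auto simp: card_insert_if)
    also have "\<dots> \<le> card (derived G (carrier G))"
      using sub fin derived_in_carrier[OF subset_refl] by (intro card_mono) (auto intro: finite_subset)
    finally have "1 + card (conj_class G b) \<le> card (derived G (carrier G))" .
    moreover have "{\<one>\<^bsub>G\<^esub>} \<union> conj_class G b \<subseteq> derived G (carrier G)" using sub by simp
    ultimately show ?thesis
      by (intro conjI allI impI ballI two_class_last_row[OF fin gt2 \<xi>]) simp_all
  qed
  have unique: "\<exists>!C. special_class G C \<and> C \<noteq> {\<one>\<^bsub>G\<^esub>}" if cd1: "CD1_group G"
  proof -
    have gt2: "Coset.order G > 2" using cd1 by (simp add: CD1_group_def)
    obtain \<xi> b where \<xi>: "two_class_character \<xi> b"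
      using cd1 CD1_group_iff_two_class[OF fin gt2] by blast
    show ?thesis
      unfolding special_class_iff_two_class[OF fin gt2]
    proof (rule ex1I[of _ "conj_class G b"])
      show "\<exists>\<chi> c. two_class_character \<chi> c \<and> conj_class G b = conj_class G c" using \<xi> by blast
    qed (use two_class_character_unique[OF fin gt2 \<xi>] in blast)
  qed
  have part_b: "CD1_group G \<longleftrightarrow>
      (\<exists>\<chi>\<in>Irr G. card {C \<in> conj_classes G. \<exists>x\<in>C. \<chi> x \<noteq> 0} = 2)" if gt2: "Coset.order G > 2"
  proof -
    have "CD1_group G \<longleftrightarrow> (\<exists>\<chi>\<in>Irr G. \<exists>b. two_class_character \<chi> b)"
      unfolding CD1_group_iff_two_class[OF fin gt2] using two_class_D(1)[OF fin gt2] by blast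
    also have "\<dots> \<longleftrightarrow> (\<exists>\<chi>\<in>Irr G. card {C \<in> conj_classes G. \<exists>x\<in>C. \<chi> x \<noteq> 0} = 2)"
      by (intro bex_cong refl nonvanishing_classes_iff_two_class[OF fin gt2, symmetric])
    finally show ?thesis .
  qed
  show ?thesis using part_a unique part_b by (intro conjI impI ballI) simp_all
qed

end
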